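(* Every root system is isomorphic (as a generalized root system) to a quotient of a simply-laced root system.
   Context: Root systems here are the irreducible reduced crystallographic root systems $X_l$ of types $A_l,B_l,C_l,D_l,E_6,E_7,E_8,F_4,G_2$, with the vector $0$ included in the set, considered in the Euclidean space they span. Simply-laced means of type $A$, $D$ or $E$. A generalized root system (GRS) is a pair $(R,V)$ where $V$ is a finite-dimensional Euclidean space and $R\subset V$ is a non-empty finite set such that: (i) $V=\operatorname{span} R$; (ii) for all $\alpha,\beta\in R$: if $\langle\alpha,\beta\rangle<0$ then $\alpha+\beta\in R$; if $\langle\alpha,\beta\rangle>0$ then $\alpha-\beta\in R$; if $\langle\alpha,\beta\rangle=0$ then $\alpha+\beta\in R$ if and only if $\alpha-\beta\in R$. Root systems are GRSs. Two irreducible GRSs $(R_1,V_1)$, $(R_2,V_2)$ are isomorphic if there is a conformal linear isomorphism $V_1\to V_2$ (an isometry up to a positive scalar) mapping $R_1$ bijectively onto $R_2$. Given a root system $R\subset V$, a base $S$ of $R$ (set of simple roots) and a subset $I\subset S$, the quotient of $R$ with respect to $I$ is $R/I:=\pi_I(R)\subset(\operatorname{span} I)^\perp$, where $\pi_I:V\to(\operatorname{span} I)^\perp$ is the orthogonal projection. It is a GRS in $(\operatorname{span} I)^\perp$. *)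

theory Defs
  imports "HOL-Analysis.Analysis"
begin

section \<open>An ambient space for Euclidean spaces of every finite dimension\<close>

text \<open>
  An existential statement about a root system of unspecified rank needs one type that contains
  Euclidean spaces of all dimensions. Finitely supported real sequences with the standard inner
  product serve this purpose: see \<open>euclidean_embeds_fin_seq\<close> below.
\<close>

typedef fin_seq = "{f :: nat \<Rightarrow> real. finite {i. f i \<noteq> 0}}"
  morphisms seq_nth Abs_fin_seq
  by (rule exI[of _ "\<lambda>_. 0"]) simp

setup_lifting type_definition_fin_seq

lemma finite_support [simp]: "finite {i. seq_nth x i \<noteq> 0}"
  using seq_nth[of x] by simp

lemma fin_seq_eqI: "(\<And>i. seq_nth x i = seq_nth y i) \<Longrightarrow> x = y"
  by (simp add: seq_nth_inject[symmetric] fun_eq_iff)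

instantiation fin_seq :: real_vector
begin

lift_definition zero_fin_seq :: fin_seq is "\<lambda>_. 0" by simp

lift_definition plus_fin_seq :: "fin_seq \<Rightarrow> fin_seq \<Rightarrow> fin_seq" is "\<lambda>f g i. f i + g i"
  subgoal for f g
    by (rule finite_subset[of _ "{i. f i \<noteq> 0} \<union> {i. g i \<noteq> 0}"]) auto
  done

lift_definition minus_fin_seq :: "fin_seq \<Rightarrow> fin_seq \<Rightarrow> fin_seq" is "\<lambda>f g i. f i - g i"
  subgoal for f g
    by (rule finite_subset[of _ "{i. f i \<noteq> 0} \<union> {i. g i \<noteq> 0}"]) auto
  done

lift_definition uminus_fin_seq :: "fin_seq \<Rightarrow> fin_seq" is "\<lambda>f i. - f i" by simp

lift_definition scaleR_fin_seq :: "real \<Rightarrow> fin_seq \<Rightarrow> fin_seq" is "\<lambda>c f i. c * f i"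
  subgoal for c f
    by (rule finite_subset[of _ "{i. f i \<noteq> 0}"]) auto
  done

instance
  by standard (transfer; simp add: algebra_simps fun_eq_iff)+

end

instantiation fin_seq :: real_inner
begin

definition inner_fin_seq :: "fin_seq \<Rightarrow> fin_seq \<Rightarrow> real" where
  "inner_fin_seq x y = (\<Sum>i\<in>{i. seq_nth x i \<noteq> 0}. seq_nth x i * seq_nth y i)"

definition norm_fin_seq :: "fin_seq \<Rightarrow> real" where
  "norm_fin_seq x = sqrt (inner x x)"

definition sgn_fin_seq :: "fin_seq \<Rightarrow> fin_seq" where
  "sgn_fin_seq x = x /\<^sub>R norm x"

definition dist_fin_seq :: "fin_seq \<Rightarrow> fin_seq \<Rightarrow> real" where
  "dist_fin_seq x y = norm (x - y)"

definition uniformity_fin_seq :: "(fin_seq \<times> fin_seq) filter" where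
  "uniformity_fin_seq = (INF e\<in>{0<..}. principal {(x, y). dist x y < e})"

definition open_fin_seq :: "fin_seq set \<Rightarrow> bool" where
  "open_fin_seq U \<longleftrightarrow> (\<forall>x\<in>U. eventually (\<lambda>(x', y). x' = x \<longrightarrow> y \<in> U) uniformity)"

lemma inner_fin_seq_superset:
  assumes "finite S" "{i. seq_nth x i \<noteq> 0} \<subseteq> S"
  shows "inner x y = (\<Sum>i\<in>S. seq_nth x i * seq_nth y i)"
  unfolding inner_fin_seq_def using assms by (intro sum.mono_neutral_left) auto

instance
proof
  fix x y z :: fin_seq and r :: real
  define S where "S = {i. seq_nth x i \<noteq> 0} \<union> {i. seq_nth y i \<noteq> 0}"
  have S: "finite S" "{i. seq_nth x i \<noteq> 0} \<subseteq> S" "{i. seq_nth y i \<noteq> 0} \<subseteq> S"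
    "{i. seq_nth (x + y) i \<noteq> 0} \<subseteq> S" "{i. seq_nth (r *\<^sub>R x) i \<noteq> 0} \<subseteq> S"
    by (auto simp: S_def plus_fin_seq.rep_eq scaleR_fin_seq.rep_eq)
  note eqs = inner_fin_seq_superset[OF S(1,2)] inner_fin_seq_superset[OF S(1,3)]
    inner_fin_seq_superset[OF S(1,4)] inner_fin_seq_superset[OF S(1,5)]
  show "inner x y = inner y x"
    by (simp add: eqs mult.commute)
  show "inner (x + y) z = inner x z + inner y z"
    by (simp add: eqs plus_fin_seq.rep_eq sum.distrib algebra_simps)
  show "inner (r *\<^sub>R x) y = r * inner x y"
    by (simp add: eqs scaleR_fin_seq.rep_eq sum_distrib_left algebra_simps)
  show "0 \<le> inner x x"
    by (simp add: inner_fin_seq_def sum_nonneg)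
  show "inner x x = 0 \<longleftrightarrow> x = 0"
    by (auto simp: inner_fin_seq_def sum_nonneg_eq_0_iff zero_fin_seq.rep_eq intro!: fin_seq_eqI)
qed (simp_all add: norm_fin_seq_def sgn_fin_seq_def dist_fin_seq_def uniformity_fin_seq_def
      open_fin_seq_def)

end

lemma euclidean_embeds_fin_seq:
  "\<exists>f :: 'a::euclidean_space \<Rightarrow> fin_seq. linear f \<and> (\<forall>x y. inner (f x) (f y) = inner x y)"
proof -
  obtain e :: "nat \<Rightarrow> 'a" where e: "bij_betw e {..<DIM('a)} Basis"
    using ex_bij_betw_nat_finite[OF finite_Basis] by (auto simp: lessThan_atLeast0)
  define f :: "'a \<Rightarrow> fin_seq"
    where "f x = Abs_fin_seq (\<lambda>i. if i < DIM('a) then inner x (e i) else 0)" for x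
  have nth: "seq_nth (f x) i = (if i < DIM('a) then inner x (e i) else 0)" for x i
    unfolding f_def by (subst Abs_fin_seq_inverse) auto
  have "linear f"
    by (rule linearI; rule fin_seq_eqI)
      (auto simp: nth plus_fin_seq.rep_eq scaleR_fin_seq.rep_eq inner_add_left)
  moreover have "inner (f x) (f y) = inner x y" for x y
  proof -
    have "inner (f x) (f y) = (\<Sum>i<DIM('a). inner x (e i) * inner y (e i))"
      by (subst inner_fin_seq_superset[of "{..<DIM('a)}"]) (auto simp: nth intro!: sum.cong)
    also have "\<dots> = (\<Sum>b\<in>Basis. inner x b * inner y b)"
      by (rule sum.reindex_bij_betw[OF e])
    finally show ?thesis by (simp add: euclidean_inner[of x y])
  qed
  ultimately show ?thesis by blast
qed


section \<open>Generalized root systems\<close>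

text \<open>The Euclidean space \<open>V\<close> is a subspace of an ambient real inner product space; it is
  finite-dimensional because it is spanned by the finite set \<open>R\<close>.\<close>

definition grs :: "'a::real_inner set \<Rightarrow> 'a set \<Rightarrow> bool" where
  "grs R V \<longleftrightarrow>
     finite R \<and> R \<noteq> {} \<and> V = span R \<and>
     (\<forall>\<alpha>\<in>R. \<forall>\<beta>\<in>R.
        (inner \<alpha> \<beta> < 0 \<longrightarrow> \<alpha> + \<beta> \<in> R) \<and>
        (inner \<alpha> \<beta> > 0 \<longrightarrow> \<alpha> - \<beta> \<in> R) \<and>
        (inner \<alpha> \<beta> = 0 \<longrightarrow> (\<alpha> + \<beta> \<in> R \<longleftrightarrow> \<alpha> - \<beta> \<in> R)))"

text \<open>Irreducibility concerns the nonzero vectors only, since \<open>0\<close> may belong to \<open>R\<close>.\<close>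

definition irreducible_roots :: "'a::real_inner set \<Rightarrow> bool" where
  "irreducible_roots R \<longleftrightarrow>
     R - {0} \<noteq> {} \<and>
     \<not> (\<exists>R\<^sub>1 R\<^sub>2. R\<^sub>1 \<noteq> {} \<and> R\<^sub>2 \<noteq> {} \<and> R - {0} = R\<^sub>1 \<union> R\<^sub>2 \<and>
            (\<forall>\<alpha>\<in>R\<^sub>1. \<forall>\<beta>\<in>R\<^sub>2. inner \<alpha> \<beta> = 0))"

text \<open>Taking \<open>f\<close> linear on the whole ambient space is no restriction, because a linear map on a
  subspace always extends.\<close>

definition grs_isomorphic ::
  "'a::real_inner set \<Rightarrow> 'a set \<Rightarrow> 'b::real_inner set \<Rightarrow> 'b set \<Rightarrow> bool" where
  "grs_isomorphic R\<^sub>1 V\<^sub>1 R\<^sub>2 V\<^sub>2 \<longleftrightarrow>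
     grs R\<^sub>1 V\<^sub>1 \<and> irreducible_roots R\<^sub>1 \<and> grs R\<^sub>2 V\<^sub>2 \<and> irreducible_roots R\<^sub>2 \<and>
     (\<exists>f c. linear f \<and> bij_betw f V\<^sub>1 V\<^sub>2 \<and>
            c > 0 \<and> (\<forall>x\<in>V\<^sub>1. norm (f x) = c * norm x) \<and>
            bij_betw f R\<^sub>1 R\<^sub>2)"


section \<open>Root systems and their types\<close>

definition cartan_integer :: "'a::real_inner \<Rightarrow> 'a \<Rightarrow> real" where
  "cartan_integer \<alpha> \<beta> = 2 * inner \<alpha> \<beta> / inner \<beta> \<beta>"

definition reduced_crystallographic :: "'a::real_inner set \<Rightarrow> bool" where
  "reduced_crystallographic R \<longleftrightarrow>
     finite R \<and> 0 \<in> R \<and>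
     (\<forall>\<alpha>\<in>R - {0}. \<forall>\<beta>\<in>R - {0}.
        cartan_integer \<beta> \<alpha> \<in> \<int> \<and> \<beta> - cartan_integer \<beta> \<alpha> *\<^sub>R \<alpha> \<in> R) \<and>
     (\<forall>\<alpha>\<in>R - {0}. \<forall>c. c *\<^sub>R \<alpha> \<in> R - {0} \<longrightarrow> c = 1 \<or> c = -1)"

definition root_base :: "'a::real_inner set \<Rightarrow> 'a set \<Rightarrow> bool" where
  "root_base S R \<longleftrightarrow>
     S \<subseteq> R \<and> independent S \<and> span S = span R \<and>
     (\<forall>\<alpha>\<in>R. \<exists>c :: 'a \<Rightarrow> nat.
        \<alpha> = (\<Sum>s\<in>S. of_nat (c s) *\<^sub>R s) \<or> \<alpha> = - (\<Sum>s\<in>S. of_nat (c s) *\<^sub>R s))"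

datatype cartan_type =
  type_A nat | type_B nat | type_C nat | type_D nat | type_E6 | type_E7 | type_E8 | type_F4 | type_G2

text \<open>The lower bounds on the ranks are the usual ones that make the list free of repetitions.\<close>

fun valid_type :: "cartan_type \<Rightarrow> bool" where
  "valid_type (type_A l) \<longleftrightarrow> l \<ge> 1"
| "valid_type (type_B l) \<longleftrightarrow> l \<ge> 2"
| "valid_type (type_C l) \<longleftrightarrow> l \<ge> 3"
| "valid_type (type_D l) \<longleftrightarrow> l \<ge> 4"
| "valid_type _ \<longleftrightarrow> True"

fun type_rank :: "cartan_type \<Rightarrow> nat" where
  "type_rank (type_A l) = l"
| "type_rank (type_B l) = l"
| "type_rank (type_C l) = l"
| "type_rank (type_D l) = l"
| "type_rank type_E6 = 6"
| "type_rank type_E7 = 7"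
| "type_rank type_E8 = 8"
| "type_rank type_F4 = 4"
| "type_rank type_G2 = 2"

definition consecutive :: "nat \<Rightarrow> nat \<Rightarrow> bool" where
  "consecutive i j \<longleftrightarrow> j = i + 1 \<or> i = j + 1"

definition E_edge :: "nat \<Rightarrow> nat \<Rightarrow> bool" where
  "E_edge i j \<longleftrightarrow> {i, j} = {1, 3} \<or> {i, j} = {2, 4} \<or> (i \<ge> 3 \<and> j \<ge> 3 \<and> consecutive i j)"

text \<open>Off-diagonal Cartan matrix entries: the entry at \<open>(i, j)\<close> is
  \<open>2 \<langle>\<alpha>\<^sub>i, \<alpha>\<^sub>j\<rangle> / \<langle>\<alpha>\<^sub>j, \<alpha>\<^sub>j\<rangle>\<close>, with simple roots numbered from 1 as in Bourbaki.
  Thus in \<open>B\<^sub>l\<close> the last simple root is short and in \<open>C\<^sub>l\<close> it is long; in \<open>F\<^sub>4\<close> the roots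
  1, 2 are long; in \<open>G\<^sub>2\<close> the root 1 is short.\<close>

fun cartan_offdiag :: "cartan_type \<Rightarrow> nat \<Rightarrow> nat \<Rightarrow> int" where
  "cartan_offdiag (type_A l) i j = (if consecutive i j then -1 else 0)"
| "cartan_offdiag (type_B l) i j =
     (if i + 1 = l \<and> j = l then -2 else if consecutive i j then -1 else 0)"
| "cartan_offdiag (type_C l) i j =
     (if i = l \<and> j + 1 = l then -2 else if consecutive i j then -1 else 0)"
| "cartan_offdiag (type_D l) i j =
     (if (i < l \<and> j < l \<and> consecutive i j) \<or> {i, j} = {l - 2, l} then -1 else 0)"
| "cartan_offdiag type_E6 i j = (if E_edge i j then -1 else 0)"
| "cartan_offdiag type_E7 i j = (if E_edge i j then -1 else 0)"
| "cartan_offdiag type_E8 i j = (if E_edge i j then -1 else 0)"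
| "cartan_offdiag type_F4 i j =
     (if i = 2 \<and> j = 3 then -2 else if consecutive i j then -1 else 0)"
| "cartan_offdiag type_G2 i j =
     (if i = 2 \<and> j = 1 then -3 else if consecutive i j then -1 else 0)"

definition cartan_matrix :: "cartan_type \<Rightarrow> nat \<Rightarrow> nat \<Rightarrow> int" where
  "cartan_matrix T i j = (if i = j then 2 else cartan_offdiag T i j)"

definition has_type :: "'a::real_inner set \<Rightarrow> cartan_type \<Rightarrow> bool" where
  "has_type R T \<longleftrightarrow>
     (\<exists>b :: nat \<Rightarrow> 'a.
        inj_on b {1..type_rank T} \<and> root_base (b ` {1..type_rank T}) R \<and>
        (\<forall>i\<in>{1..type_rank T}. \<forall>j\<in>{1..type_rank T}.
           cartan_integer (b i) (b j) = of_int (cartan_matrix T i j)))"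

definition root_system :: "'a::real_inner set \<Rightarrow> bool" where
  "root_system R \<longleftrightarrow>
     reduced_crystallographic R \<and> irreducible_roots R \<and> (\<exists>T. valid_type T \<and> has_type R T)"

fun is_ADE :: "cartan_type \<Rightarrow> bool" where
  "is_ADE (type_A l) \<longleftrightarrow> True"
| "is_ADE (type_D l) \<longleftrightarrow> True"
| "is_ADE type_E6 \<longleftrightarrow> True"
| "is_ADE type_E7 \<longleftrightarrow> True"
| "is_ADE type_E8 \<longleftrightarrow> True"
| "is_ADE _ \<longleftrightarrow> False"

definition simply_laced :: "'a::real_inner set \<Rightarrow> bool" where
  "simply_laced R \<longleftrightarrow> root_system R \<and> (\<exists>T. valid_type T \<and> is_ADE T \<and> has_type R T)"


section \<open>Quotients\<close>

definition proj_perp :: "'a::real_inner set \<Rightarrow> 'a \<Rightarrow> 'a" where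
  "proj_perp I v = (THE w. w \<in> orthogonal_comp (span I) \<and> v - w \<in> span I)"

lemma proj_perp_unique:
  assumes "w \<in> orthogonal_comp (span I)" "v - w \<in> span I"
    and "w' \<in> orthogonal_comp (span I)" "v - w' \<in> span I"
  shows "w = w'"
proof -
  have "w - w' \<in> span I"
    using span_diff[OF assms(4,2)] by simp
  moreover have "w - w' \<in> orthogonal_comp (span I)"
    using assms by (auto simp: orthogonal_comp_def orthogonal_def inner_diff_right)
  ultimately have "inner (w - w') (w - w') = 0"
    by (auto simp: orthogonal_comp_def orthogonal_def)
  then show ?thesis by simp
qed

lemma proj_perp_exists:
  assumes "finite I"
  shows "\<exists>w. w \<in> orthogonal_comp (span I) \<and> v - w \<in> span I"
  using assms
proof (induction I arbitrary: v rule: finite_induct)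
  case empty
  then show ?case
    by (intro exI[of _ v]) (auto simp: orthogonal_comp_def orthogonal_def)
next
  case (insert a I)
  obtain p where p: "\<And>y. y \<in> span I \<Longrightarrow> inner y p = 0" "a - p \<in> span I"
    using insert.IH[of a] by (auto simp: orthogonal_comp_def orthogonal_def)
  obtain q where q: "\<And>y. y \<in> span I \<Longrightarrow> inner y q = 0" "v - q \<in> span I"
    using insert.IH[of v] by (auto simp: orthogonal_comp_def orthogonal_def)
  define w where "w = q - (inner p q / inner p p) *\<^sub>R p"
  have sub: "span I \<subseteq> span (insert a I)"
    by (rule span_mono) auto
  have pin: "p \<in> span (insert a I)"
    using span_diff[of a "insert a I" "a - p"] p(2) sub by (auto simp: span_base)
  have wI: "inner y w = 0" if "y \<in> span I" for y
    using p(1) q(1) that by (simp add: w_def inner_diff_right)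
  have "inner p w = 0"
    by (cases "p = 0") (auto simp: w_def inner_diff_right)
  then have wa: "inner a w = 0"
    using wI[OF p(2)] by (simp add: inner_diff_left)
  have "w \<in> orthogonal_comp (span (insert a I))"
  proof -
    have "inner y w = 0" if y: "y \<in> span (insert a I)" for y
    proof -
      obtain k where "y - k *\<^sub>R a \<in> span I"
        using y by (auto simp: span_insert)
      from wI[OF this] wa show ?thesis by (simp add: inner_diff_left)
    qed
    then show ?thesis by (auto simp: orthogonal_comp_def orthogonal_def)
  qed
  moreover have "v - w \<in> span (insert a I)"
  proof -
    have "(v - q) + (inner p q / inner p p) *\<^sub>R p \<in> span (insert a I)"
      using q(2) sub pin by (intro span_add span_scale) auto
    then show ?thesis
      by (simp add: w_def algebra_simps)
  qed
  ultimately show ?case by blast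
qed

lemma proj_perp:
  assumes "finite I"
  shows "proj_perp I v \<in> orthogonal_comp (span I)" "v - proj_perp I v \<in> span I"
proof -
  have "\<exists>!w. w \<in> orthogonal_comp (span I) \<and> v - w \<in> span I"
    using proj_perp_exists[OF assms] proj_perp_unique by blast
  from theI'[OF this]
  show "proj_perp I v \<in> orthogonal_comp (span I)" "v - proj_perp I v \<in> span I"
    by (simp_all add: proj_perp_def)
qed

definition root_quotient :: "'a::real_inner set \<Rightarrow> 'a set \<Rightarrow> 'a set" where
  "root_quotient R I = proj_perp I ` R"

text \<open>The orthogonal complement of \<open>span I\<close> inside the space spanned by \<open>R\<close>.\<close>

definition quotient_space :: "'a::real_inner set \<Rightarrow> 'a set \<Rightarrow> 'a set" where
  "quotient_space R I = span R \<inter> orthogonal_comp (span I)"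

end

theory Submission
  imports Defs
begin

text \<open>
  Two root systems with the same Cartan matrix are isomorphic, so it suffices to find for each type
  a quotient of a simply-laced root system with a base of that type. For the types A, D and E the
  quotient by the empty set works. For the other types the idea is that of folding, with
  projections in place of diagram automorphisms:
  \<^item> \<open>B\<^sub>l\<close> is a quotient of \<open>D\<^sub>l\<^sub>+\<^sub>2\<close> by the two end nodes of the fork;
  \<^item> \<open>C\<^sub>l\<close> is a quotient of \<open>D\<^sub>2\<^sub>l\<close> by the odd nodes;
  \<^item> \<open>F\<^sub>4\<close> is a quotient of \<open>E\<^sub>7\<close> by the nodes 2, 5, 7;
  \<^item> \<open>G\<^sub>2\<close> is a quotient of \<open>E\<^sub>6\<close> by the nodes 1, 3, 5, 6.

  Comparing the quotients with the given root system does not require a list of the roots. A set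
  that contains 0 and is symmetric, has a base, is stable under the simple reflections with integral
  coefficients, and contains no multiple of a simple root \<open>s\<close> other than 0 and \<open>\<plusminus>s\<close>, consists of
  0 and the orbit of its base under the simple reflections
  (\<open>reflective_base_eq_simple_orbit\<close>). This orbit is determined by the Cartan matrix up to a
  conformal map, given irreducibility (\<open>reflective_base_isomorphic\<close>).

  That the quotients above satisfy these conditions rests on one observation. Each simple root that
  survives projects to the mean of \<open>m \<le> 3\<close> mutually orthogonal roots with the same projection, so
  the reflection in its projection is induced by a product of \<open>m\<close> commuting reflections upstairs.
  This gives stability, integrality, and, since projections do not increase length, the statement
  on multiples (\<open>quotient_reflective_base\<close>). It also identifies the coroots of the quotient, so
  its Cartan matrix is found by a computation in the Cartan matrix upstairs
  (\<open>cartan_integer_proj_perp\<close>).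

  The simply-laced root systems themselves are obtained from explicit bases as the vectors of squared
  length 2 in the lattices that these span; evenness of the lattice replaces any enumeration of roots.
\<close>

section \<open>Root systems as orbits of simple roots\<close>

lemma independent_coeffs_unique:
  assumes "finite S" "independent S" "(\<Sum>s\<in>S. f s *\<^sub>R s) = (\<Sum>s\<in>S. g s *\<^sub>R s)" "s \<in> S"
  shows "f s = g s"
proof -
  have "(\<Sum>s\<in>S. (f s - g s) *\<^sub>R s) = 0"
    using assms(3) by (simp add: scaleR_left_diff_distrib sum_subtractf)
  then have "f s - g s = 0"
    by (rule independentD[OF assms(2,1) order_refl _ assms(4)])
  then show ?thesis by simp
qed

definition reflect :: "'a::real_inner \<Rightarrow> 'a \<Rightarrow> 'a" where
  "reflect s x = x - cartan_integer x s *\<^sub>R s"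

text \<open>
  The orbit of the simple roots under the group generated by the simple reflections. It depends
  on \<open>S\<close> alone, which is why it can serve to identify root systems with equal Cartan matrices.
\<close>

inductive_set simple_orbit :: "'a::real_inner set \<Rightarrow> 'a set" for S where
  base: "s \<in> S \<Longrightarrow> s \<in> simple_orbit S"
| step: "x \<in> simple_orbit S \<Longrightarrow> s \<in> S \<Longrightarrow> reflect s x \<in> simple_orbit S"

text \<open>
  The properties of a root system with base \<open>S\<close> that determine it from \<open>S\<close>. Only the simple
  reflections and the Cartan integers against simple roots occur, because for a projected root system
  these can be lifted explicitly; a reflection in an arbitrary element would need a lift of its own.
\<close>

definition reflective_base :: "'a::real_inner set \<Rightarrow> 'a set \<Rightarrow> bool" where
  "reflective_base S X \<longleftrightarrow>
     finite S \<and> root_base S X \<and> 0 \<in> X \<and> (\<forall>x\<in>X. - x \<in> X) \<and>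
     (\<forall>x\<in>X. \<forall>s\<in>S. cartan_integer x s \<in> \<int> \<and> reflect s x \<in> X) \<and>
     (\<forall>s\<in>S. \<forall>c. c *\<^sub>R s \<in> X \<longrightarrow> c \<in> {0, 1, -1})"

lemma reflective_baseD:
  assumes "reflective_base S X"
  shows "finite S" "independent S" "S \<subseteq> X" "0 \<in> X" "span S = span X"
    and "x \<in> X \<Longrightarrow> - x \<in> X"
    and "x \<in> X \<Longrightarrow> \<exists>c :: 'a::real_inner \<Rightarrow> nat.
        x = (\<Sum>s\<in>S. of_nat (c s) *\<^sub>R s) \<or> x = - (\<Sum>s\<in>S. of_nat (c s) *\<^sub>R s)"
    and "x \<in> X \<Longrightarrow> s \<in> S \<Longrightarrow> cartan_integer x s \<in> \<int>"
    and "x \<in> X \<Longrightarrow> s \<in> S \<Longrightarrow> reflect s x \<in> X"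
    and "s \<in> S \<Longrightarrow> c *\<^sub>R s \<in> X \<Longrightarrow> c \<in> {0, 1, -1}"
  using assms unfolding reflective_base_def root_base_def by simp_all

lemma cartan_integer_self: "s \<noteq> 0 \<Longrightarrow> cartan_integer s s = 2"
  by (simp add: cartan_integer_def)

lemma reflect_self: "s \<noteq> 0 \<Longrightarrow> reflect s s = - s"
  by (simp add: reflect_def cartan_integer_self scaleR_2)

lemma cartan_integer_diff_scaleR:
  "cartan_integer (x - c *\<^sub>R y) s = cartan_integer x s - c * cartan_integer y s"
  by (simp add: cartan_integer_def inner_diff_left algebra_simps diff_divide_distrib)

lemma reflect_reflect: "reflect s (reflect s x) = x"
proof (cases "s = 0")
  case False
  then show ?thesis
    by (simp add: reflect_def cartan_integer_diff_scaleR cartan_integer_self algebra_simps scaleR_2)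
qed (simp add: reflect_def)

lemma reflect_minus: "reflect s (- x) = - reflect s x"
  by (simp add: reflect_def cartan_integer_def)

lemma reflect_zero [simp]: "reflect s 0 = 0"
  by (simp add: reflect_def cartan_integer_def)

lemma reflect_eq_0_iff: "reflect s x = 0 \<longleftrightarrow> x = 0"
  by (metis reflect_reflect reflect_zero)

lemma simple_orbit_minus:
  assumes "0 \<notin> S" "x \<in> simple_orbit S"
  shows "- x \<in> simple_orbit S"
  using assms(2)
proof induction
  case (base s)
  then show ?case
    using simple_orbit.step[OF simple_orbit.base, OF base base] reflect_self[of s] assms(1)
    by metis
next
  case (step x s)
  then show ?case
    using simple_orbit.step[of "- x" S s] by (simp add: reflect_minus)
qed

lemma simple_orbit_subset:
  assumes "reflective_base S X"
  shows "simple_orbit S \<subseteq> X - {0}"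
proof
  fix x assume "x \<in> simple_orbit S"
  then show "x \<in> X - {0}"
  proof induction
    case (base s)
    then show ?case
      using reflective_baseD(2,3)[OF assms] dependent_zero by blast
  next
    case (step x s)
    then show ?case
      using reflective_baseD(9)[OF assms] by (simp add: reflect_eq_0_iff)
  qed
qed

text \<open>
  Descent on the height. As \<open>\<langle>x, x\<rangle> > 0\<close>, some simple \<open>s\<close> in the support of \<open>x\<close> has
  \<open>\<langle>x, s\<rangle> > 0\<close>, so reflecting in \<open>s\<close> subtracts a positive integer multiple of \<open>s\<close>. If \<open>x\<close> has
  a further simple root in its support, that coefficient is unchanged and forces the reflected
  vector to be positive again, of smaller height. Otherwise \<open>x\<close> is a multiple of \<open>s\<close>, hence \<open>s\<close>.
\<close>

lemma positive_in_simple_orbit: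
  fixes c :: "'a::real_inner \<Rightarrow> nat"
  assumes wb: "reflective_base S X"
    and x: "x \<in> X" "x \<noteq> 0" "x = (\<Sum>s\<in>S. of_nat (c s) *\<^sub>R s)"
  shows "x \<in> simple_orbit S"
  using x
proof (induction "sum c S" arbitrary: c x rule: less_induct)
  case less
  note S = reflective_baseD[OF wb]
  have "0 < inner x x" using less.prems by simp
  also have "inner x x = (\<Sum>s\<in>S. of_nat (c s) * inner s x)"
    by (subst (1) less.prems(3)) (simp add: inner_sum_left)
  finally obtain s where s: "s \<in> S" "0 < of_nat (c s) * inner s x"
    by (meson leD not_le sum_nonpos)
  then have sx: "0 < inner x s" "0 < c s"
    by (auto simp: inner_commute zero_less_mult_iff)
  have s0: "s \<noteq> 0" using sx by auto
  obtain k :: int where k: "cartan_integer x s = of_int k"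
    using S(8)[OF less.prems(1) s(1)] by (auto elim: Ints_cases)
  have "cartan_integer x s > 0"
    unfolding cartan_integer_def using sx s0 by simp
  then have "k > 0" using k by simp
  define y where "y = reflect s x"
  have yX: "y \<in> X" unfolding y_def using S(9) less.prems(1) s(1) by blast
  have y0: "y \<noteq> 0" using less.prems(2) by (simp add: y_def reflect_eq_0_iff)
  \<comment> \<open>The coefficients of \<open>y\<close>: those of \<open>x\<close>, lowered by \<open>k\<close> at \<open>s\<close>.\<close>
  define d where "d t = (if t = s then of_int (int (c s) - k) else of_nat (c t) :: real)" for t
  have yd: "y = (\<Sum>t\<in>S. d t *\<^sub>R t)"
  proof -
    have "(\<Sum>t\<in>S. d t *\<^sub>R t) = (\<Sum>t\<in>S. of_nat (c t) *\<^sub>R t - (if t = s then of_int k *\<^sub>R s else 0))"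
      by (rule sum.cong) (auto simp: d_def algebra_simps)
    also have "\<dots> = x - of_int k *\<^sub>R s"
      using S(1) s(1) less.prems(3) by (simp add: sum_subtractf)
    finally show ?thesis by (simp add: y_def reflect_def k)
  qed
  show ?case
  proof (cases "\<exists>t\<in>S. t \<noteq> s \<and> c t > 0")
    case False
    then have "x = of_nat (c s) *\<^sub>R s"
      using S(1) s(1) less.prems(3)
      by (subst less.prems(3)) (subst sum.mono_neutral_right[of S "{s}"], auto)
    with S(10)[of s "of_nat (c s)"] s(1) less.prems(1) sx(2) have "x = s" by auto
    then show ?thesis using s(1) simple_orbit.base by blast
  next
    case True
    then obtain t where t: "t \<in> S" "t \<noteq> s" "c t > 0" by blast
    obtain e :: "'a \<Rightarrow> nat" where e: "y = (\<Sum>s\<in>S. of_nat (e s) *\<^sub>R s) \<or> y = - (\<Sum>s\<in>S. of_nat (e s) *\<^sub>R s)"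
      using S(7)[OF yX] by blast
    have "y \<noteq> - (\<Sum>s\<in>S. of_nat (e s) *\<^sub>R s)"
    proof
      assume "y = - (\<Sum>s\<in>S. of_nat (e s) *\<^sub>R s)"
      then have "(\<Sum>t\<in>S. d t *\<^sub>R t) = (\<Sum>s\<in>S. (- of_nat (e s)) *\<^sub>R s)"
        using yd by (simp add: sum_negf)
      from independent_coeffs_unique[OF S(1,2) this t(1)] t show False
        by (simp add: d_def)
    qed
    with e have ye: "y = (\<Sum>s\<in>S. of_nat (e s) *\<^sub>R s)" by blast
    have de: "d u = of_nat (e u)" if "u \<in> S" for u
      using independent_coeffs_unique[OF S(1,2) _ that, of d "\<lambda>s. of_nat (e s)"] yd ye by simp
    have es: "e u \<le> c u" if "u \<in> S" for u
    proof (cases "u = s")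
      case True
      have "real_of_int (int (c s) - k) = of_nat (e s)" using de[OF s(1)] by (simp add: d_def)
      then have "int (c s) - k = int (e s)" by linarith
      then show ?thesis using \<open>k > 0\<close> True by simp
    next
      case False
      then show ?thesis using de[OF that] by (simp add: d_def)
    qed
    have "real_of_int (int (c s) - k) = of_nat (e s)" using de[OF s(1)] by (simp add: d_def)
    then have "int (c s) - k = int (e s)" by linarith
    then have "e s < c s" using \<open>k > 0\<close> by simp
    then have "sum e S < sum c S"
      using S(1) s(1) es by (intro sum_strict_mono_ex1) auto
    from less.hyps[OF this yX y0 ye] have "reflect s y \<in> simple_orbit S"
      using s(1) by (rule simple_orbit.step)
    then show ?thesis by (simp add: y_def reflect_reflect)
  qed
qed

lemma reflective_base_eq_simple_orbit:
  assumes wb: "reflective_base S X"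
  shows "X = insert 0 (simple_orbit S)"
proof -
  note S = reflective_baseD[OF wb]
  have "x \<in> simple_orbit S" if x: "x \<in> X" "x \<noteq> 0" for x
  proof -
    obtain c :: "'a \<Rightarrow> nat"
      where "x = (\<Sum>s\<in>S. of_nat (c s) *\<^sub>R s) \<or> x = - (\<Sum>s\<in>S. of_nat (c s) *\<^sub>R s)"
      using S(7)[OF x(1)] by blast
    then show ?thesis
    proof
      assume "x = (\<Sum>s\<in>S. of_nat (c s) *\<^sub>R s)"
      then show ?thesis using positive_in_simple_orbit[OF wb x] by blast
    next
      assume "x = - (\<Sum>s\<in>S. of_nat (c s) *\<^sub>R s)"
      then have "- x \<in> simple_orbit S"
        using positive_in_simple_orbit[OF wb S(6)[OF x(1)]] x(2) by simp
      then show ?thesis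
        using simple_orbit_minus[of S "- x"] S(2) dependent_zero by fastforce
    qed
  qed
  then show ?thesis using simple_orbit_subset[OF wb] S(4) by blast
qed

lemma reduced_crystallographic_minus:
  assumes "reduced_crystallographic R" "x \<in> R"
  shows "- x \<in> R"
proof (cases "x = 0")
  case False
  then have "reflect x x \<in> R"
    using assms unfolding reduced_crystallographic_def reflect_def by blast
  then show ?thesis by (simp add: reflect_self False)
qed (use assms in simp)

lemma reduced_crystallographic_reflective_base:
  assumes R: "reduced_crystallographic R" and S: "root_base S R"
  shows "reflective_base S R"
proof -
  have fin: "finite S"
    using R S finite_subset unfolding reduced_crystallographic_def root_base_def by blast
  have S0: "0 \<notin> S" and SR: "S \<subseteq> R"
    using S dependent_zero unfolding root_base_def by blast+
  have "cartan_integer x s \<in> \<int> \<and> reflect s x \<in> R" if "x \<in> R" "s \<in> S" for x s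
  proof (cases "x = 0")
    case False
    have "s \<in> R - {0}" using that S0 SR by blast
    with False show ?thesis
      using R that(1) unfolding reduced_crystallographic_def reflect_def by blast
  qed (use R in \<open>simp add: reduced_crystallographic_def cartan_integer_def\<close>)
  moreover have "c \<in> {0, 1, -1}" if "s \<in> S" "c *\<^sub>R s \<in> R" for s c
  proof (cases "c = 0")
    case False
    have "s \<in> R - {0}" using that(1) S0 SR by blast
    moreover have "c *\<^sub>R s \<in> R - {0}" using that(2) False calculation by simp
    ultimately show ?thesis
      using R unfolding reduced_crystallographic_def by blast
  qed simp
  moreover have "0 \<in> R" using R by (simp add: reduced_crystallographic_def)
  moreover note fin S reduced_crystallographic_minus[OF R]
  ultimately show ?thesis unfolding reflective_base_def by (intro conjI ballI allI impI) auto
qed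

text \<open>
  If \<open>\<langle>a, b\<rangle> > 0\<close>, the two Cartan integers of \<open>a\<close> and \<open>b\<close> are positive. If one of them is 1,
  the corresponding reflection produces \<open>\<plusminus>(a - b)\<close>. If both are at least 2, then
  \<open>2\<langle>a, b\<rangle> \<ge> \<langle>a, a\<rangle> + \<langle>b, b\<rangle>\<close>, that is \<open>a = b\<close>, and \<open>a - b = 0\<close> belongs to \<open>R\<close>. For orthogonal
  \<open>a, b\<close> the reflection in \<open>b\<close> exchanges \<open>a + b\<close> and \<open>a - b\<close>.
\<close>

lemma reduced_crystallographic_grs:
  fixes R :: "'a::real_inner set"
  assumes R: "reduced_crystallographic R"
  shows "grs R (span R)"
proof -
  have refl: "cartan_integer x y \<in> \<int>" "reflect y x \<in> R" if "x \<in> R" "y \<in> R" "y \<noteq> 0" for x y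
  proof -
    have "cartan_integer x y \<in> \<int> \<and> reflect y x \<in> R"
    proof (cases "x = 0")
      case False
      then show ?thesis
        using R that unfolding reduced_crystallographic_def reflect_def by blast
    qed (use R in \<open>simp add: reduced_crystallographic_def cartan_integer_def\<close>)
    then show "cartan_integer x y \<in> \<int>" "reflect y x \<in> R" by auto
  qed
  have R0: "0 \<in> R" using R by (simp add: reduced_crystallographic_def)
  have diff: "a - b \<in> R" if ab: "a \<in> R" "b \<in> R" "0 < inner a b" for a b
  proof -
    have n0: "a \<noteq> 0" "b \<noteq> 0" using ab(3) by auto
    obtain k :: int where k: "cartan_integer a b = of_int k"
      using refl(1)[OF ab(1,2) n0(2)] by (auto elim: Ints_cases)
    obtain l :: int where l: "cartan_integer b a = of_int l"
      using refl(1)[OF ab(2,1) n0(1)] by (auto elim: Ints_cases)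
    have eqs: "2 * inner a b = k * inner b b" "2 * inner a b = l * inner a a"
      using k l n0 by (simp_all add: cartan_integer_def field_simps inner_commute)
    have "0 < cartan_integer a b" "0 < cartan_integer b a"
      using ab(3) n0 by (simp_all add: cartan_integer_def inner_commute)
    then have pos: "k > 0" "l > 0"
      using k l by simp_all
    show ?thesis
    proof (cases "k = 1 \<or> l = 1")
      case True
      then show ?thesis
      proof
        assume "k = 1"
        then show ?thesis using refl(2)[OF ab(1,2) n0(2)] by (simp add: reflect_def k)
      next
        assume "l = 1"
        then have "b - a \<in> R" using refl(2)[OF ab(2,1) n0(1)] by (simp add: reflect_def l)
        from reduced_crystallographic_minus[OF R this] show ?thesis by simp
      qed
    next
      case False
      then have kl: "k \<ge> 2" "l \<ge> 2" using pos by auto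
      have "inner (a - b) (a - b) = inner a a + inner b b - 2 * inner a b"
        by (simp add: inner_diff inner_commute)
      also have "\<dots> \<le> 0"
      proof -
        have "2 * inner b b \<le> k * inner b b" "2 * inner a a \<le> l * inner a a"
          using kl by (intro mult_right_mono; simp)+
        then show ?thesis using eqs by linarith
      qed
      finally have "inner (a - b) (a - b) = 0"
        using inner_ge_zero[of "a - b"] by linarith
      then have "a = b" by simp
      then show ?thesis using R0 by simp
    qed
  qed
  have add: "a + b \<in> R" if "a \<in> R" "b \<in> R" "inner a b < 0" for a b
    using diff[of a "- b"] reduced_crystallographic_minus[OF R] that by auto
  have orth: "a - b \<in> R" if ab: "b \<in> R" "inner a b = 0" "a + b \<in> R" for a b
  proof (cases "b = 0")
    case False
    then have "cartan_integer (a + b) b = 2"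
      using ab(2) by (simp add: cartan_integer_def inner_add_left)
    then show ?thesis
      using refl(2)[OF ab(3,1) False] by (simp add: reflect_def scaleR_2 algebra_simps)
  qed (use ab in simp)
  have "a + b \<in> R \<longleftrightarrow> a - b \<in> R" if "b \<in> R" "inner a b = 0" for a b
    using orth[of b a] orth[of "- b" a] reduced_crystallographic_minus[OF R, of b] that
    by (metis add_uminus_conv_diff diff_minus_eq_add inner_minus_right neg_equal_zero)
  moreover have "finite R" using R by (simp add: reduced_crystallographic_def)
  ultimately show ?thesis
    unfolding grs_def using R0 add diff by blast
qed

section \<open>Simply-laced root systems from even lattices\<close>

definition root_lattice :: "'a::real_inner set \<Rightarrow> 'a set" where
  "root_lattice S = range (\<lambda>c :: 'a \<Rightarrow> int. \<Sum>s\<in>S. of_int (c s) *\<^sub>R s)"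

text \<open>
  Simply-laced root systems are realised as the vectors of squared length 2 in the even lattice
  spanned by a base. This makes closure under reflections immediate, and it avoids listing the
  roots of each type.
\<close>

definition lattice_roots :: "'a::real_inner set \<Rightarrow> 'a set" where
  "lattice_roots S = insert 0 {v \<in> root_lattice S. inner v v = 2}"

definition simply_laced_base :: "'a::real_inner set \<Rightarrow> bool" where
  "simply_laced_base S \<longleftrightarrow> finite S \<and> independent S \<and>
     (\<forall>s\<in>S. \<forall>t\<in>S. if s = t then inner s t = 2 else inner s t \<in> {0, -1})"

lemma simply_laced_baseD:
  assumes "simply_laced_base S"
  shows "finite S" "independent S"
    and "s \<in> S \<Longrightarrow> inner s s = 2"
    and "s \<in> S \<Longrightarrow> t \<in> S \<Longrightarrow> s \<noteq> t \<Longrightarrow> inner s t \<in> {0, -1}"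
  using assms unfolding simply_laced_base_def by (simp, simp, metis, metis)

lemma root_latticeI: "x = (\<Sum>s\<in>S. of_int (c s) *\<^sub>R s) \<Longrightarrow> x \<in> root_lattice S"
  unfolding root_lattice_def by (rule range_eqI[of _ _ c])

lemma root_lattice_base:
  assumes "finite S" "s \<in> S" shows "s \<in> root_lattice S"
proof -
  have "s = (\<Sum>t\<in>S. of_int (if t = s then 1 else 0) *\<^sub>R t)"
    using assms by (simp add: if_distrib[of real_of_int] if_distrib[of "\<lambda>r. r *\<^sub>R _"] cong: if_cong)
  then show ?thesis by (rule root_latticeI)
qed

lemma root_lattice_diff:
  assumes "x \<in> root_lattice S" "y \<in> root_lattice S"
  shows "x - y \<in> root_lattice S"
proof -
  obtain c d where "x = (\<Sum>s\<in>S. of_int (c s) *\<^sub>R s)" "y = (\<Sum>s\<in>S. of_int (d s) *\<^sub>R s)"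
    using assms unfolding root_lattice_def by blast
  then have "x - y = (\<Sum>s\<in>S. of_int (c s - d s) *\<^sub>R s)"
    by (simp add: algebra_simps sum_subtractf)
  then show ?thesis by (rule root_latticeI)
qed

lemma root_lattice_zero: "0 \<in> root_lattice S"
  unfolding root_lattice_def by (rule range_eqI[of _ _ "\<lambda>_. 0"]) simp

lemma root_lattice_add:
  assumes "x \<in> root_lattice S" "y \<in> root_lattice S"
  shows "x + y \<in> root_lattice S"
  using root_lattice_diff[OF assms(1) root_lattice_diff[OF root_lattice_zero assms(2)]] by simp

lemma root_lattice_scale:
  assumes "x \<in> root_lattice S" "k \<in> \<int>"
  shows "k *\<^sub>R x \<in> root_lattice S"
proof -
  obtain c where "x = (\<Sum>s\<in>S. of_int (c s) *\<^sub>R s)"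
    using assms unfolding root_lattice_def by blast
  moreover obtain l where "k = of_int l" using assms(2) Ints_cases by blast
  ultimately have "k *\<^sub>R x = (\<Sum>s\<in>S. of_int (l * c s) *\<^sub>R s)"
    by (simp add: scaleR_sum_right)
  then show ?thesis by (rule root_latticeI)
qed

lemma root_lattice_sum:
  "(\<And>i. i \<in> A \<Longrightarrow> f i \<in> root_lattice S) \<Longrightarrow> sum f A \<in> root_lattice S"
  by (induction A rule: infinite_finite_induct) (auto intro: root_lattice_add root_lattice_zero)

lemma root_lattice_subset_span: "root_lattice S \<subseteq> span S"
  unfolding root_lattice_def by (auto intro: span_sum span_scale span_base)

lemma root_lattice_inner:
  assumes S: "simply_laced_base S" and "x \<in> root_lattice S" "y \<in> root_lattice S"
  shows "inner x y \<in> \<int>"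
proof -
  have st: "inner s t \<in> \<int>" if "s \<in> S" "t \<in> S" for s t
    using simply_laced_baseD(3,4)[OF S] that by (cases "s = t") fastforce+
  obtain c d where "x = (\<Sum>s\<in>S. of_int (c s) *\<^sub>R s)" "y = (\<Sum>s\<in>S. of_int (d s) *\<^sub>R s)"
    using assms unfolding root_lattice_def by blast
  then have "inner x y = (\<Sum>s\<in>S. of_int (c s) * (\<Sum>t\<in>S. of_int (d t) * inner s t))"
    by (simp only: inner_sum_left inner_scaleR_left) (simp add: inner_sum_right)
  also have "\<dots> \<in> \<int>"
    using st by (intro Ints_sum Ints_mult) auto
  finally show ?thesis .
qed

text \<open>
  Adding a multiple \<open>c a\<close> of a base vector to \<open>y\<close> changes the squared length by
  \<open>2 c\<^sup>2 + 2 c \<langle>a, y\<rangle>\<close>, which is even because the lattice is integral.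
\<close>

lemma root_lattice_even:
  assumes S: "simply_laced_base S" and "x \<in> root_lattice S"
  shows "\<exists>k::int. inner x x = 2 * of_int k"
proof -
  note D = simply_laced_baseD[OF S]
  obtain c where c: "x = (\<Sum>s\<in>S. of_int (c s) *\<^sub>R s)"
    using assms unfolding root_lattice_def by blast
  have "\<exists>k::int. inner (\<Sum>s\<in>F. of_int (c s) *\<^sub>R s) (\<Sum>s\<in>F. of_int (c s) *\<^sub>R s) = 2 * of_int k"
    if "finite F" "F \<subseteq> S" for F
    using that
  proof (induction F rule: finite_induct)
    case empty
    show ?case by (intro exI[of _ 0]) simp
  next
    case (insert a F)
    define y where "y = (\<Sum>s\<in>F. of_int (c s) *\<^sub>R s)"
    obtain k :: int where k: "inner y y = 2 * of_int k"
      using insert unfolding y_def by auto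
    have aS: "a \<in> root_lattice S" "inner a a = 2"
      using insert.prems D(1,3) root_lattice_base by auto
    have "y \<in> root_lattice S"
      unfolding y_def using insert.prems root_lattice_base[OF D(1)]
      by (intro root_lattice_sum root_lattice_scale) auto
    then obtain l :: int where l: "inner a y = of_int l"
      using root_lattice_inner[OF S aS(1)] Ints_cases by blast
    have "inner (of_int (c a) *\<^sub>R a + y) (of_int (c a) *\<^sub>R a + y)
        = 2 * of_int (c a * c a + c a * l + k)"
      using k l aS(2) by (simp add: inner_add inner_commute algebra_simps)
    then show ?case
      using insert.hyps unfolding y_def by (subst (1 2) sum.insert) (auto simp del: of_int_add of_int_mult)
  qed
  from this[OF D(1) order_refl] show ?thesis using c by simp
qed

lemma root_lattice_norm_ge_2:
  assumes S: "simply_laced_base S" and "x \<in> root_lattice S" "x \<noteq> 0"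
  shows "inner x x \<ge> 2"
proof -
  obtain k :: int where k: "inner x x = 2 * of_int k"
    using root_lattice_even[OF assms(1,2)] by blast
  have "inner x x > 0" using assms(3) by simp
  then have "k \<ge> 1" using k by simp
  then show ?thesis using k by simp
qed

text \<open>
  Split \<open>v = p - q\<close> into its positive and negative parts. They have disjoint supports, and distinct
  simple roots have inner product at most 0, so \<open>\<langle>p, q\<rangle> \<le> 0\<close> and \<open>\<langle>p, p\<rangle> + \<langle>q, q\<rangle> \<le> 2\<close>. Nonzero
  lattice vectors have squared length at least 2, hence \<open>p\<close> or \<open>q\<close> vanishes.
\<close>

lemma lattice_roots_signed:
  assumes S: "simply_laced_base S" and v: "v \<in> lattice_roots S"
  shows "\<exists>c :: 'a::real_inner \<Rightarrow> nat.
     v = (\<Sum>s\<in>S. of_nat (c s) *\<^sub>R s) \<or> v = - (\<Sum>s\<in>S. of_nat (c s) *\<^sub>R s)"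
proof (cases "v = 0")
  case True
  then show ?thesis by (intro exI[of _ "\<lambda>_. 0"]) simp
next
  case False
  note D = simply_laced_baseD[OF S]
  from False v have v2: "v \<in> root_lattice S" "inner v v = 2"
    unfolding lattice_roots_def by auto
  obtain c :: "'a \<Rightarrow> int" where c: "v = (\<Sum>s\<in>S. of_int (c s) *\<^sub>R s)"
    using v2 unfolding root_lattice_def by blast
  define p where "p = (\<Sum>s\<in>S. of_nat (nat (c s)) *\<^sub>R s)"
  define q where "q = (\<Sum>s\<in>S. of_nat (nat (- c s)) *\<^sub>R s)"
  have vpq: "v = p - q"
    unfolding c p_def q_def sum_subtractf[symmetric] scaleR_left_diff_distrib[symmetric]
    by (rule sum.cong) auto
  have lat: "p \<in> root_lattice S" "q \<in> root_lattice S"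
    unfolding p_def q_def using root_lattice_base[OF D(1)]
    by (intro root_lattice_sum root_lattice_scale; simp)+
  have "inner p q = (\<Sum>s\<in>S. \<Sum>t\<in>S. of_nat (nat (c s) * nat (- c t)) * inner s t)"
    by (simp only: p_def q_def inner_sum_left inner_scaleR_left)
      (simp add: inner_sum_right sum_distrib_left mult.assoc)
  also have "\<dots> \<le> 0"
  proof (intro sum_nonpos)
    fix s t assume "s \<in> S" "t \<in> S"
    then show "of_nat (nat (c s) * nat (- c t)) * inner s t \<le> 0"
      using D(4)[of s t] by (cases "s = t") (auto simp: mult_le_0_iff)
  qed
  finally have "inner p p + inner q q \<le> 2"
    using v2(2) unfolding vpq by (simp add: inner_diff inner_commute)
  then have "p = 0 \<or> q = 0"
    using root_lattice_norm_ge_2[OF S lat(1)] root_lattice_norm_ge_2[OF S lat(2)] by fastforce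
  then show ?thesis
    using vpq unfolding p_def q_def by auto
qed

lemma proj_perp_inner:
  assumes "finite I" "y \<in> span I"
  shows "inner (proj_perp I v) y = 0" "inner y (proj_perp I v) = 0"
  using proj_perp(1)[OF assms(1), of v] assms(2)
  by (auto simp: orthogonal_comp_def orthogonal_def inner_commute)

text \<open>
  The coefficient of \<open>v\<close> at \<open>s\<close> is read off by pairing with the component \<open>w s\<close> of \<open>s\<close>
  orthogonal to the other simple roots, so by Cauchy-Schwarz it is bounded by
  \<open>sqrt 2 / norm (w s)\<close>.
\<close>

lemma finite_lattice_roots:
  assumes S: "simply_laced_base S"
  shows "finite (lattice_roots S)"
proof -
  note D = simply_laced_baseD[OF S]
  define w where "w s = proj_perp (S - {s}) s" for s
  have fin: "finite (S - {s})" for s using D(1) by simp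
  have w_other: "inner t (w s) = 0" if "t \<in> S - {s}" for s t
    unfolding w_def by (rule proj_perp_inner(2)[OF fin span_base[OF that]])
  have w_self: "inner s (w s) = inner (w s) (w s)" for s
    using proj_perp_inner(2)[OF fin proj_perp(2)[OF fin], of s s s]
    by (simp add: w_def inner_diff_left)
  have w_nonzero: "w s \<noteq> 0" if "s \<in> S" for s
    using proj_perp(2)[OF fin, of s s] D(2) that unfolding dependent_def w_def by auto
  define C where "C s = {k :: int. \<bar>of_int k\<bar> \<le> sqrt 2 / norm (w s)}" for s
  have finC: "finite (C s)" for s
  proof (rule finite_subset)
    show "C s \<subseteq> {- \<lceil>sqrt 2 / norm (w s)\<rceil>..\<lceil>sqrt 2 / norm (w s)\<rceil>}"
      unfolding C_def by (auto simp: abs_le_iff) linarith+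
  qed simp
  have "v \<in> insert 0 ((\<lambda>c. \<Sum>s\<in>S. of_int (c s) *\<^sub>R s) ` Pi\<^sub>E S C)" if "v \<in> lattice_roots S" for v
  proof (cases "v = 0")
    case False
    with that have v2: "v \<in> root_lattice S" "inner v v = 2"
      unfolding lattice_roots_def by auto
    then obtain c :: "'a \<Rightarrow> int" where c: "v = (\<Sum>s\<in>S. of_int (c s) *\<^sub>R s)"
      unfolding root_lattice_def by blast
    have "c s \<in> C s" if s: "s \<in> S" for s
    proof -
      have "inner v (w s) = (\<Sum>t\<in>S. of_int (c t) * inner t (w s))"
        by (simp add: c inner_sum_left)
      also have "\<dots> = of_int (c s) * inner (w s) (w s)"
        using D(1) s w_other by (subst sum.remove[of S s]) (auto simp: w_self intro!: sum.neutral)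
      finally have "\<bar>of_int (c s)\<bar> * inner (w s) (w s) = \<bar>inner v (w s)\<bar>"
        by (simp add: abs_mult)
      also have "\<dots> \<le> norm v * norm (w s)" by (rule Cauchy_Schwarz_ineq2)
      also have "norm v = sqrt 2" using v2(2) by (simp add: norm_eq_sqrt_inner)
      finally have "\<bar>of_int (c s)\<bar> * norm (w s) \<le> sqrt 2"
        using w_nonzero[OF s] by (simp add: power2_norm_eq_inner[symmetric] power2_eq_square)
      then show ?thesis
        using w_nonzero[OF s] by (simp add: C_def field_simps)
    qed
    then have "restrict c S \<in> Pi\<^sub>E S C" by auto
    moreover have "v = (\<Sum>s\<in>S. of_int (restrict c S s) *\<^sub>R s)" by (simp add: c)
    ultimately show ?thesis by blast
  qed simp
  then have "lattice_roots S \<subseteq> insert 0 ((\<lambda>c. \<Sum>s\<in>S. of_int (c s) *\<^sub>R s) ` Pi\<^sub>E S C)"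
    by blast
  then show ?thesis
    by (rule finite_subset) (simp add: finite_PiE D(1) finC)
qed

lemma lattice_roots_base: "simply_laced_base S \<Longrightarrow> S \<subseteq> lattice_roots S"
  using root_lattice_base simply_laced_baseD(1,3) unfolding lattice_roots_def by blast

lemma lattice_roots_root_base:
  assumes S: "simply_laced_base S"
  shows "root_base S (lattice_roots S)"
proof -
  have "lattice_roots S \<subseteq> span S"
    using root_lattice_subset_span[of S] span_zero unfolding lattice_roots_def by auto
  then have "span (lattice_roots S) = span S"
    using lattice_roots_base[OF S] span_mono span_minimal[OF _ subspace_span] by blast
  then show ?thesis
    unfolding root_base_def
    using lattice_roots_signed[OF S] lattice_roots_base[OF S] simply_laced_baseD(2)[OF S] by auto
qed

lemma lattice_roots_reduced_crystallographic:
  assumes S: "simply_laced_base S"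
  shows "reduced_crystallographic (lattice_roots S)"
proof -
  have mem: "v \<in> root_lattice S" "inner v v = 2" if "v \<in> lattice_roots S - {0}" for v
    using that unfolding lattice_roots_def by auto
  have "cartan_integer \<beta> \<alpha> \<in> \<int> \<and> \<beta> - cartan_integer \<beta> \<alpha> *\<^sub>R \<alpha> \<in> lattice_roots S"
    if "\<alpha> \<in> lattice_roots S - {0}" "\<beta> \<in> lattice_roots S - {0}" for \<alpha> \<beta>
  proof -
    note a = mem[OF that(1)] and b = mem[OF that(2)]
    have k: "cartan_integer \<beta> \<alpha> = inner \<beta> \<alpha>" "inner \<beta> \<alpha> \<in> \<int>"
      using a b root_lattice_inner[OF S] by (auto simp: cartan_integer_def)
    have "inner (\<beta> - inner \<beta> \<alpha> *\<^sub>R \<alpha>) (\<beta> - inner \<beta> \<alpha> *\<^sub>R \<alpha>) = 2"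
      using a b by (simp add: inner_diff inner_commute algebra_simps)
    then show ?thesis
      using k a b unfolding lattice_roots_def
      by (auto intro!: root_lattice_diff root_lattice_scale)
  qed
  moreover have "c = 1 \<or> c = -1" if "\<alpha> \<in> lattice_roots S - {0}" "c *\<^sub>R \<alpha> \<in> lattice_roots S - {0}" for \<alpha> c
    using mem(2)[OF that(1)] mem(2)[OF that(2)] by (simp add: square_eq_1_iff)
  ultimately show ?thesis
    unfolding reduced_crystallographic_def using finite_lattice_roots[OF S]
    by (intro conjI ballI allI impI) (auto simp: lattice_roots_def)
qed

text \<open>
  Connectedness of the Dynkin diagram enters through a function \<open>h\<close> that decreases along a path
  from any node to the node \<open>r\<close>. In an orthogonal splitting of the roots all simple roots then lie
  in the part containing \<open>r\<close>; a root in the other part is orthogonal to the span of the simple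
  roots, hence to itself.
\<close>

lemma lattice_roots_irreducible:
  fixes h :: "'a::real_inner \<Rightarrow> nat"
  assumes S: "simply_laced_base S" and r: "r \<in> S"
    and step: "\<And>s. s \<in> S \<Longrightarrow> s \<noteq> r \<Longrightarrow> \<exists>t\<in>S. h t < h s \<and> inner s t \<noteq> 0"
  shows "irreducible_roots (lattice_roots S)"
proof -
  have sub: "S \<subseteq> lattice_roots S - {0}"
    using lattice_roots_base[OF S] simply_laced_baseD(2)[OF S] dependent_zero by blast
  have False if R: "r \<in> R1" "R2 \<noteq> {}" "lattice_roots S - {0} = R1 \<union> R2"
    and orth: "\<And>a b. a \<in> R1 \<Longrightarrow> b \<in> R2 \<Longrightarrow> inner a b = 0" for R1 R2
  proof -
    have "s \<in> R1" if "s \<in> S" for s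
      using that
    proof (induction "h s" arbitrary: s rule: less_induct)
      case less
      show ?case
      proof (cases "s = r")
        case False
        then obtain t where t: "t \<in> S" "h t < h s" "inner s t \<noteq> 0"
          using step less.prems by blast
        then have "t \<in> R1" using less.hyps by blast
        then have "s \<notin> R2" using orth t(3) by (metis inner_commute)
        then show ?thesis using less.prems sub R(3) by blast
      qed (use R in simp)
    qed
    moreover obtain b where b: "b \<in> R2" using R(2) by blast
    ultimately have "orthogonal b s" if "s \<in> S" for s
      using orth[of s b] that by (simp add: orthogonal_def inner_commute)
    moreover have "b \<in> span S" "b \<noteq> 0"
      using b R(3) lattice_roots_root_base[OF S] span_base unfolding root_base_def by blast+
    ultimately show False
      using orthogonal_to_span[of b S b] by (simp add: orthogonal_self)
  qed
  note split = this
  show ?thesis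
    unfolding irreducible_roots_def
  proof (intro conjI notI)
    assume "lattice_roots S - {0} = {}"
    then show False using sub r by blast
  next
    assume "\<exists>R1 R2. R1 \<noteq> {} \<and> R2 \<noteq> {} \<and> lattice_roots S - {0} = R1 \<union> R2 \<and>
            (\<forall>\<alpha>\<in>R1. \<forall>\<beta>\<in>R2. inner \<alpha> \<beta> = 0)"
    then obtain R1 R2 where R: "R1 \<noteq> {}" "R2 \<noteq> {}" "lattice_roots S - {0} = R1 \<union> R2"
      "\<forall>a\<in>R1. \<forall>b\<in>R2. inner a b = 0" by (elim exE conjE) simp
    have "r \<in> R1 \<or> r \<in> R2" using sub r R(3) by blast
    then show False
    proof
      assume "r \<in> R1"
      then show False using split[OF _ R(2,3)] R(4) by simp
    next
      assume "r \<in> R2"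
      have un: "lattice_roots S - {0} = R2 \<union> R1" using R(3) by blast
      have orth: "inner a b = 0" if "a \<in> R2" "b \<in> R1" for a b
        using R(4) that by (simp add: inner_commute[of a b])
      show False by (rule split[OF \<open>r \<in> R2\<close> R(1) un orth])
    qed
  qed
qed

section \<open>Projections and orthogonal lifts\<close>

lemma proj_perp_eqI:
  assumes "v - w \<in> span I" "\<And>t. t \<in> I \<Longrightarrow> inner w t = 0"
  shows "proj_perp I v = w"
proof -
  have "orthogonal w y" if "y \<in> span I" for y
    using orthogonal_to_span[OF that, of w] assms(2) by (simp add: orthogonal_def)
  then have w: "w \<in> orthogonal_comp (span I)"
    by (simp add: orthogonal_comp_def orthogonal_commute)
  show ?thesis
    unfolding proj_perp_def
  proof (rule the_equality)
    show "w' = w" if "w' \<in> orthogonal_comp (span I) \<and> v - w' \<in> span I" for w'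
      using proj_perp_unique[of w' I v w] that w assms(1) by blast
  qed (use w assms(1) in blast)
qed

lemma linear_proj_perp:
  assumes "finite I"
  shows "linear (proj_perp I)"
proof (rule linearI)
  note span = proj_perp(2)[OF assms] and orth = proj_perp_inner(1)[OF assms span_base]
  fix x y :: 'a and c :: real
  show "proj_perp I (x + y) = proj_perp I x + proj_perp I y"
    using span_add[OF span[of x] span[of y]] orth
    by (intro proj_perp_eqI) (auto simp: algebra_simps inner_add_left)
  show "proj_perp I (c *\<^sub>R x) = c *\<^sub>R proj_perp I x"
    using span_scale[OF span[of x], of c] orth
    by (intro proj_perp_eqI) (auto simp: algebra_simps)
qed

lemma proj_perp_eq_0_iff:
  assumes "finite I"
  shows "proj_perp I v = 0 \<longleftrightarrow> v \<in> span I"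
  using proj_perp(2)[OF assms, of v] proj_perp_eqI[of v 0 I] by auto

lemma norm_proj_perp_le:
  assumes "finite I"
  shows "inner (proj_perp I v) (proj_perp I v) \<le> inner v v"
proof -
  define u where "u = v - proj_perp I v"
  have v: "v = proj_perp I v + u" by (simp add: u_def)
  have "inner (proj_perp I v) u = 0"
    unfolding u_def by (rule proj_perp_inner(1)[OF assms proj_perp(2)[OF assms]])
  then have "inner v v = inner (proj_perp I v) (proj_perp I v) + inner u u"
    by (subst (1 2) v) (simp add: inner_add inner_commute)
  then show ?thesis using inner_ge_zero[of u] by linarith
qed

lemma inner_proj_perp:
  assumes "finite I"
  shows "inner (proj_perp I v) (proj_perp I w) = inner v (proj_perp I w)"
  using proj_perp_inner(2)[OF assms proj_perp(2)[OF assms, of v], of w]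
  by (simp add: inner_diff_left)

text \<open>
  When does the reflection in the projection of a simple root \<open>s\<close> come from the root system
  upstairs? It does if \<open>s\<close> is congruent modulo \<open>span I\<close> to each of \<open>m\<close> mutually orthogonal
  roots whose sum \<open>\<sigma>\<close> is orthogonal to \<open>I\<close>: then \<open>s\<close> projects to \<open>\<sigma> / m\<close>, a vector of squared
  length \<open>2 / m\<close>, and the product of the \<open>m\<close> commuting reflections descends to the reflection in it.
  The bound \<open>m \<le> 3\<close> makes the result reduced: if \<open>c\<close> times this vector is the projection of a
  root, then \<open>2 c\<^sup>2 / m \<le> 2\<close>, so an integer \<open>c\<close> is 0 or \<open>\<plusminus>1\<close>.
\<close>

definition orthogonal_lift :: "'a::real_inner set \<Rightarrow> 'a set \<Rightarrow> 'a \<Rightarrow> 'a \<Rightarrow> bool" where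
  "orthogonal_lift S I s \<sigma> \<longleftrightarrow>
     (\<exists>A. finite A \<and> A \<subseteq> lattice_roots S - {0} \<and> card A \<in> {1, 2, 3} \<and>
          (\<forall>a\<in>A. \<forall>b\<in>A. a \<noteq> b \<longrightarrow> inner a b = 0) \<and> (\<forall>a\<in>A. a - s \<in> span I) \<and>
          \<sigma> = \<Sum>A \<and> (\<forall>t\<in>I. inner \<sigma> t = 0))"

lemma orthogonal_lift_proj:
  assumes S: "simply_laced_base S" and I: "I \<subseteq> S" and lift: "orthogonal_lift S I s \<sigma>"
  obtains m :: nat and A where "m \<in> {1, 2, 3}" "proj_perp I s = \<sigma> /\<^sub>R real m"
    "inner \<sigma> \<sigma> = 2 * real m"
    "finite A" "A \<subseteq> lattice_roots S - {0}" "\<sigma> = \<Sum>A"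
    "\<And>a b. a \<in> A \<Longrightarrow> b \<in> A \<Longrightarrow> inner a b = (if a = b then 2 else 0)"
    "\<And>a. a \<in> A \<Longrightarrow> proj_perp I a = proj_perp I s"
proof -
  have finI: "finite I" using I simply_laced_baseD(1)[OF S] finite_subset by blast
  obtain A where A: "finite A" "A \<subseteq> lattice_roots S - {0}" "card A \<in> {1, 2, 3}"
    "\<forall>a\<in>A. \<forall>b\<in>A. a \<noteq> b \<longrightarrow> inner a b = 0" "\<forall>a\<in>A. a - s \<in> span I"
    "\<sigma> = \<Sum>A" "\<forall>t\<in>I. inner \<sigma> t = 0"
    using lift unfolding orthogonal_lift_def by (elim exE conjE)
  have inner: "inner a b = (if a = b then 2 else 0)" if "a \<in> A" "b \<in> A" for a b
    using that A(2,4) unfolding lattice_roots_def by auto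
  have m0: "real (card A) \<noteq> 0" using A(3) by auto
  have "proj_perp I s = \<sigma> /\<^sub>R real (card A)"
  proof (rule proj_perp_eqI)
    have "(\<Sum>a\<in>A. a - s) \<in> span I" using A(5) by (intro span_sum) auto
    then have "(- 1 / real (card A)) *\<^sub>R (\<Sum>a\<in>A. a - s) \<in> span I" by (rule span_scale)
    also have "(- 1 / real (card A)) *\<^sub>R (\<Sum>a\<in>A. a - s) = s - \<sigma> /\<^sub>R real (card A)"
      using m0 by (simp add: sum_subtractf A(6) scaleR_right_diff_distrib scaleR_conv_of_real
          sum_constant_scaleR field_simps)
    finally show "s - \<sigma> /\<^sub>R real (card A) \<in> span I" .
  qed (use A(7) in simp)
  moreover have "inner \<sigma> \<sigma> = 2 * real (card A)"
    using A(1) inner by (simp add: A(6) inner_sum_left inner_sum_right cong: sum.cong)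
  moreover have "proj_perp I a = proj_perp I s" if "a \<in> A" for a
  proof -
    have "proj_perp I (a - s) = 0" using A(5) that proj_perp_eq_0_iff[OF finI] by blast
    then show ?thesis using linear_diff[OF linear_proj_perp[OF finI]] by simp
  qed
  ultimately show ?thesis
    using A(1,2,3,6) inner by (intro that[of "card A" A]) auto
qed

text \<open>
  With \<open>s\<close> projecting to \<open>\<sigma> / m\<close> and \<open>\<langle>\<sigma>, \<sigma>\<rangle> = 2 m\<close>, the sum \<open>\<sigma>\<close> is exactly the coroot of the
  projected root. The Cartan matrix of the quotient is therefore computed upstairs.
\<close>

lemma cartan_integer_proj_perp:
  assumes S: "simply_laced_base S" and I: "I \<subseteq> S" and lift: "orthogonal_lift S I s \<sigma>"
  shows "cartan_integer (proj_perp I v) (proj_perp I s) = inner v \<sigma>"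
proof -
  have finI: "finite I" using I simply_laced_baseD(1)[OF S] finite_subset by blast
  from orthogonal_lift_proj[OF assms] obtain m :: nat
    where m: "m \<in> {1, 2, 3}" "proj_perp I s = \<sigma> /\<^sub>R real m" "inner \<sigma> \<sigma> = 2 * real m"
    by metis
  have "real m \<noteq> 0" using m(1) by auto
  moreover have "inner (proj_perp I v) (proj_perp I s) = inner v \<sigma> / real m"
    by (subst inner_proj_perp[OF finI]) (simp add: m(2) divide_inverse)
  moreover have "inner (proj_perp I s) (proj_perp I s) = 2 / real m"
    using calculation(1) by (simp add: m(2,3) field_simps)
  ultimately show ?thesis
    unfolding cartan_integer_def by simp
qed

text \<open>
  The root \<open>w\<close> is the image of \<open>v\<close> under the product of the reflections in the \<open>m\<close> orthogonal roots.
\<close>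

lemma reflect_proj_perp:
  assumes S: "simply_laced_base S" and I: "I \<subseteq> S" and lift: "orthogonal_lift S I s \<sigma>"
    and v: "v \<in> lattice_roots S"
  shows "\<exists>w\<in>lattice_roots S. reflect (proj_perp I s) (proj_perp I v) = proj_perp I w"
proof (cases "v = 0")
  case True
  then show ?thesis
    using v proj_perp_eqI[of 0 0 I] by (intro bexI[of _ 0]) (auto simp: span_zero)
next
  case False
  have finI: "finite I" using I simply_laced_baseD(1)[OF S] finite_subset by blast
  note lin = linear_proj_perp[OF finI]
  have v2: "v \<in> root_lattice S" "inner v v = 2"
    using v False unfolding lattice_roots_def by auto
  from orthogonal_lift_proj[OF S I lift] obtain A where
    A: "finite A" "A \<subseteq> lattice_roots S - {0}" "\<sigma> = \<Sum>A"
      "\<And>a b. a \<in> A \<Longrightarrow> b \<in> A \<Longrightarrow> inner a b = (if a = b then 2 else 0)"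
      "\<And>a. a \<in> A \<Longrightarrow> proj_perp I a = proj_perp I s" by metis
  define u where "u = (\<Sum>a\<in>A. inner v a *\<^sub>R a)"
  have Alat: "a \<in> root_lattice S" if "a \<in> A" for a
    using A(2) that unfolding lattice_roots_def by auto
  have "v - u \<in> root_lattice S"
    unfolding u_def
    using v2(1) Alat root_lattice_inner[OF S v2(1)]
    by (intro root_lattice_diff root_lattice_sum root_lattice_scale) auto
  moreover have "inner (v - u) (v - u) = 2"
  proof -
    have "inner v u = (\<Sum>a\<in>A. (inner v a)\<^sup>2)"
      by (simp add: u_def inner_sum_right power2_eq_square)
    moreover have "inner u u = (\<Sum>a\<in>A. inner v a * inner a u)"
      by (subst u_def) (simp add: inner_sum_left)
    moreover have "inner a u = 2 * inner v a" if "a \<in> A" for a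
      using A(1) that A(4)[OF that] by (simp add: u_def inner_sum_right if_distrib[of "\<lambda>r. _ * r"] cong: if_cong)
    ultimately have "inner u u = 2 * inner v u"
      by (simp add: sum_distrib_left power2_eq_square mult.left_commute cong: sum.cong)
    then show ?thesis
      using v2(2) by (simp add: inner_diff inner_commute)
  qed
  ultimately have "v - u \<in> lattice_roots S" unfolding lattice_roots_def by blast
  moreover have "reflect (proj_perp I s) (proj_perp I v) = proj_perp I (v - u)"
  proof -
    have "proj_perp I u = (\<Sum>a\<in>A. inner v a *\<^sub>R proj_perp I s)"
      using A(5) by (simp add: u_def linear_sum[OF lin] linear_scale[OF lin])
    also have "\<dots> = inner v \<sigma> *\<^sub>R proj_perp I s"
      by (simp add: A(3) inner_sum_right scaleR_sum_left)
    finally show ?thesis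
      by (simp add: reflect_def cartan_integer_proj_perp[OF S I lift] linear_diff[OF lin])
  qed
  ultimately show ?thesis by blast
qed

text \<open>
  The kernel of the projection is \<open>span I\<close>, which by independence meets \<open>span (S - I)\<close>
  only in 0.
\<close>

lemma inj_on_proj_perp:
  assumes "finite S" "independent S" "I \<subseteq> S"
  shows "inj_on (proj_perp I) (span (S - I))"
proof -
  have finI: "finite I" using assms finite_subset by blast
  have "v = 0" if v: "v \<in> span (S - I)" "proj_perp I v = 0" for v
  proof -
    have "v \<in> span I" using v(2) proj_perp_eq_0_iff[OF finI] by blast
    then obtain f where f: "v = (\<Sum>s\<in>I. f s *\<^sub>R s)"
      unfolding span_finite[OF finI] by blast
    obtain g where g: "v = (\<Sum>s\<in>S - I. g s *\<^sub>R s)"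
      using v(1) assms(1) span_finite[of "S - I"] by auto
    have "(\<Sum>s\<in>S. (if s \<in> I then f s else 0) *\<^sub>R s) = v"
      using assms by (subst sum.mono_neutral_right[of S I]) (auto simp: f)
    moreover have "(\<Sum>s\<in>S. (if s \<in> I then 0 else g s) *\<^sub>R s) = v"
      using assms by (subst sum.mono_neutral_right[of S "S - I"]) (auto simp: g)
    ultimately have "(\<Sum>s\<in>S. (if s \<in> I then f s else 0) *\<^sub>R s) =
        (\<Sum>s\<in>S. (if s \<in> I then 0 else g s) *\<^sub>R s)" by simp
    note coeff = independent_coeffs_unique[OF assms(1,2) this]
    have "g s = 0" if "s \<in> S - I" for s
      using coeff[of s] that by simp
    then show ?thesis using g by simp
  qed
  then show ?thesis
    using linear_inj_on_iff_eq_0[OF linear_proj_perp[OF finI] subspace_span] by blast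
qed

text \<open>
  The surviving simple roots stay independent, and a combination of simple roots with coefficients of
  one sign projects to one of the same kind. The orthogonal lifts provide integrality, stability under
  the simple reflections and the bound on multiples.
\<close>

lemma quotient_reflective_base:
  fixes S :: "'a::real_inner set"
  assumes S: "simply_laced_base S" and I: "I \<subseteq> S"
    and lift: "\<And>s. s \<in> S - I \<Longrightarrow> \<exists>\<sigma>. orthogonal_lift S I s \<sigma>"
  shows "reflective_base (proj_perp I ` (S - I)) (root_quotient (lattice_roots S) I)"
    and "span (root_quotient (lattice_roots S) I) = quotient_space (lattice_roots S) I"
proof -
  note D = simply_laced_baseD[OF S]
  note RB = lattice_roots_root_base[OF S, unfolded root_base_def]
  have finI: "finite I" using I D(1) finite_subset by blast
  note lin = linear_proj_perp[OF finI]
  let ?p = "proj_perp I" and ?T = "proj_perp I ` (S - I)"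
    and ?X = "root_quotient (lattice_roots S) I"
  have inj: "inj_on ?p (span (S - I))" by (rule inj_on_proj_perp[OF D(1,2) I])
  have injb: "inj_on ?p (S - I)" using inj by (rule inj_on_subset) (rule span_superset)
  have finT: "finite ?T" using D(1) by simp
  have ind: "independent ?T"
    using linear_independent_injective_image[OF lin _ inj] D(2) independent_mono by blast
  have p_sum: "?p (\<Sum>s\<in>S. c s *\<^sub>R s) = (\<Sum>t\<in>?T. c (the_inv_into (S - I) ?p t) *\<^sub>R t)" for c
  proof -
    have "?p (\<Sum>s\<in>S. c s *\<^sub>R s) = (\<Sum>s\<in>S. c s *\<^sub>R ?p s)"
      by (simp add: linear_sum[OF lin] linear_scale[OF lin])
    also have "\<dots> = (\<Sum>s\<in>S - I. c s *\<^sub>R ?p s)"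
      using D(1) proj_perp_eq_0_iff[OF finI] span_base[of _ I]
      by (intro sum.mono_neutral_right) auto
    also have "\<dots> = (\<Sum>t\<in>?T. c (the_inv_into (S - I) ?p t) *\<^sub>R t)"
      unfolding sum.reindex[OF injb] o_def
      by (rule sum.cong) (simp_all only: the_inv_into_f_f[OF injb])
    finally show ?thesis .
  qed
  have quotE: "\<exists>v\<in>lattice_roots S. x = ?p v" if "x \<in> ?X" for x
    using that by (auto simp: root_quotient_def)
  have signed: "\<exists>c :: 'a \<Rightarrow> nat.
      x = (\<Sum>t\<in>?T. of_nat (c t) *\<^sub>R t) \<or> x = - (\<Sum>t\<in>?T. of_nat (c t) *\<^sub>R t)" if xX: "x \<in> ?X" for x
  proof -
    obtain v where v: "v \<in> lattice_roots S" "x = ?p v" using quotE[OF xX] by blast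
    obtain c :: "'a \<Rightarrow> nat"
      where "v = (\<Sum>s\<in>S. of_nat (c s) *\<^sub>R s) \<or> v = - (\<Sum>s\<in>S. of_nat (c s) *\<^sub>R s)"
      using lattice_roots_signed[OF S v(1)] by blast
    then have "x = ?p (\<Sum>s\<in>S. of_nat (c s) *\<^sub>R s) \<or> x = - ?p (\<Sum>s\<in>S. of_nat (c s) *\<^sub>R s)"
      using v(2) linear_neg[OF lin] by auto
    then show ?thesis
      unfolding p_sum by (intro exI[of _ "\<lambda>t. c (the_inv_into (S - I) ?p t)"])
  qed
  have span_img: "span (?p ` B) = ?p ` span B" for B
    by (rule linear_span_image[OF lin])
  have pS: "?p ` span S = span ?T"
  proof
    have "?p (\<Sum>s\<in>S. c s *\<^sub>R s) \<in> span ?T" for c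
      unfolding p_sum by (intro span_sum span_scale span_base)
    then show "?p ` span S \<subseteq> span ?T"
      unfolding span_finite[OF D(1)] by blast
    show "span ?T \<subseteq> ?p ` span S"
      unfolding span_img by (intro image_mono span_mono) auto
  qed
  have spanX: "span ?X = span ?T"
    using RB pS span_img[of "lattice_roots S"] by (simp add: root_quotient_def)
  have "span ?T = span S \<inter> orthogonal_comp (span I)"
  proof
    show "span ?T \<subseteq> span S \<inter> orthogonal_comp (span I)"
    proof
      fix x assume "x \<in> span ?T"
      then obtain v where v: "v \<in> span S" "x = ?p v" using pS by blast
      have "v - x \<in> span S"
        using proj_perp(2)[OF finI, of v] span_mono[OF I] v(2) by blast
      then have "x \<in> span S" using span_diff[OF v(1)] by fastforce
      then show "x \<in> span S \<inter> orthogonal_comp (span I)"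
        using proj_perp(1)[OF finI] v(2) by blast
    qed
    show "span S \<inter> orthogonal_comp (span I) \<subseteq> span ?T"
    proof
      fix x assume x: "x \<in> span S \<inter> orthogonal_comp (span I)"
      then have "?p x = x"
        by (intro proj_perp_eqI)
          (auto simp: span_zero orthogonal_comp_def orthogonal_def inner_commute span_base)
      then show "x \<in> span ?T" using x pS by force
    qed
  qed
  then show "span ?X = quotient_space (lattice_roots S) I"
    unfolding quotient_space_def using spanX RB by simp
  have TX: "?T \<subseteq> ?X"
    unfolding root_quotient_def using lattice_roots_base[OF S] by blast
  have base: "root_base ?T ?X"
    unfolding root_base_def using TX ind spanX signed by (intro conjI ballI) simp_all
  have zero: "0 \<in> ?X"
    unfolding root_quotient_def lattice_roots_def using linear_0[OF lin] by force
  have minus: "- x \<in> ?X" if xX: "x \<in> ?X" for x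
  proof -
    obtain v where v: "v \<in> lattice_roots S" "x = ?p v" using quotE[OF xX] by blast
    then show ?thesis
      using reduced_crystallographic_minus[OF lattice_roots_reduced_crystallographic[OF S] v(1)]
        linear_neg[OF lin, of v] unfolding root_quotient_def by (intro image_eqI[of _ _ "- v"]) auto
  qed
  have refl: "cartan_integer x t \<in> \<int> \<and> reflect t x \<in> ?X" if xt: "x \<in> ?X" "t \<in> ?T" for x t
  proof -
    obtain v where v: "v \<in> lattice_roots S" "x = ?p v" using quotE[OF xt(1)] by blast
    obtain s where s: "s \<in> S - I" "t = ?p s" using xt(2) by blast
    obtain \<sigma> where \<sigma>: "orthogonal_lift S I s \<sigma>" using lift[OF s(1)] by blast
    obtain A where "A \<subseteq> lattice_roots S - {0}" "\<sigma> = \<Sum>A"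
      using orthogonal_lift_proj[OF S I \<sigma>] by metis
    then have "\<sigma> \<in> root_lattice S"
      by (auto simp: lattice_roots_def intro!: root_lattice_sum)
    moreover have "v \<in> root_lattice S"
      using v(1) root_lattice_zero unfolding lattice_roots_def by auto
    ultimately have "inner v \<sigma> \<in> \<int>" by (intro root_lattice_inner[OF S])
    then show ?thesis
      using cartan_integer_proj_perp[OF S I \<sigma>, of v] reflect_proj_perp[OF S I \<sigma> v(1)] v(2) s(2)
      unfolding root_quotient_def by auto
  qed
  have mult: "c \<in> {0, 1, -1}" if t: "t \<in> ?T" and ct: "c *\<^sub>R t \<in> ?X" for t c
  proof -
    obtain v where v: "v \<in> lattice_roots S" "c *\<^sub>R t = ?p v" using quotE[OF ct] by blast
    obtain s where s: "s \<in> S - I" "t = ?p s" using t by blast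
    obtain \<sigma> where \<sigma>: "orthogonal_lift S I s \<sigma>" using lift[OF s(1)] by blast
    obtain m :: nat where m: "m \<in> {1, 2, 3}" "t = \<sigma> /\<^sub>R real m" "inner \<sigma> \<sigma> = 2 * real m"
      using orthogonal_lift_proj[OF S I \<sigma>] s(2) by metis
    have m0: "real m > 0" using m(1) by auto
    have "c\<^sup>2 * (2 / real m) = inner (c *\<^sub>R t) (c *\<^sub>R t)"
      using m0 by (simp add: m(2,3) power2_eq_square field_simps)
    also have "\<dots> \<le> inner v v" unfolding v(2) by (rule norm_proj_perp_le[OF finI])
    also have "\<dots> \<le> 2" using v(1) by (auto simp: lattice_roots_def)
    finally have "c\<^sup>2 \<le> real m" using m0 by (simp add: field_simps)
    then have c2: "c\<^sup>2 < 4" using m(1) by auto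
    obtain d :: "'a \<Rightarrow> nat"
      where d: "c *\<^sub>R t = (\<Sum>t\<in>?T. of_nat (d t) *\<^sub>R t) \<or> c *\<^sub>R t = - (\<Sum>t\<in>?T. of_nat (d t) *\<^sub>R t)"
      using signed[OF ct] by blast
    have ct_sum: "c *\<^sub>R t = (\<Sum>u\<in>?T. (if u = t then c else 0) *\<^sub>R u)"
      using t finT by (simp add: if_distrib[of "\<lambda>r. r *\<^sub>R _"] cong: if_cong)
    \<comment> \<open>By independence, \<open>c\<close> is the coefficient of \<open>c t\<close> at \<open>t\<close>, hence an integer.\<close>
    from d have "c = of_nat (d t) \<or> c = - of_nat (d t)"
    proof
      assume "c *\<^sub>R t = (\<Sum>t\<in>?T. of_nat (d t) *\<^sub>R t)"
      with ct_sum have "(\<Sum>u\<in>?T. (if u = t then c else 0) *\<^sub>R u) = (\<Sum>u\<in>?T. of_nat (d u) *\<^sub>R u)"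
        by metis
      from independent_coeffs_unique[OF finT ind this t] show ?thesis by simp
    next
      assume "c *\<^sub>R t = - (\<Sum>t\<in>?T. of_nat (d t) *\<^sub>R t)"
      with ct_sum have "(\<Sum>u\<in>?T. (if u = t then c else 0) *\<^sub>R u) = - (\<Sum>u\<in>?T. of_nat (d u) *\<^sub>R u)"
        by metis
      then have "(\<Sum>u\<in>?T. (if u = t then c else 0) *\<^sub>R u) = (\<Sum>u\<in>?T. (- of_nat (d u)) *\<^sub>R u)"
        by (simp add: sum_negf)
      from independent_coeffs_unique[OF finT ind this t] show ?thesis by simp
    qed
    moreover have "d t < 2"
    proof (rule ccontr)
      assume "\<not> d t < 2"
      then have "real (d t) \<ge> 2" by simp
      then have "(real (d t))\<^sup>2 \<ge> 2\<^sup>2" by (intro power_mono) auto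
      then show False using c2 calculation by auto
    qed
    ultimately show ?thesis by (auto simp: less_2_cases_iff)
  qed
  show "reflective_base ?T ?X"
    unfolding reflective_base_def using finT base zero minus refl mult
    by (intro conjI ballI allI impI) simp_all
qed

section \<open>Isomorphism from equal Cartan matrices\<close>

lemma conformal_on_span:
  assumes f: "linear f" and B: "\<And>x y. x \<in> B \<Longrightarrow> y \<in> B \<Longrightarrow> inner (f x) (f y) = \<kappa> * inner x y"
    and x: "x \<in> span B" and y: "y \<in> span B"
  shows "inner (f x) (f y) = \<kappa> * inner x y"
proof -
  have sub: "subspace {y. inner (f z) (f y) = \<kappa> * inner z y}" for z
    unfolding subspace_def
    by (auto simp: linear_0[OF f] linear_add[OF f] linear_scale[OF f] inner_add_right algebra_simps)
  have 1: "inner (f z) (f y) = \<kappa> * inner z y" if "z \<in> B" for z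
    using span_minimal[OF _ sub, of B z] B[OF that] y by blast
  have "B \<subseteq> {z. inner (f y) (f z) = \<kappa> * inner y z}"
    using 1 by (auto simp: inner_commute)
  then have "inner (f y) (f x) = \<kappa> * inner y x"
    using span_minimal[OF _ sub] x by blast
  then show ?thesis by (simp add: inner_commute)
qed

lemma simple_orbit_in_span: "x \<in> simple_orbit S \<Longrightarrow> x \<in> span S"
proof (induction rule: simple_orbit.induct)
  case (step x s)
  then show ?case by (simp add: reflect_def span_diff span_scale span_base)
qed (rule span_base)

lemma irreducible_rootsD:
  assumes "irreducible_roots R" "R - {0} = R1 \<union> R2" "\<And>\<alpha> \<beta>. \<alpha> \<in> R1 \<Longrightarrow> \<beta> \<in> R2 \<Longrightarrow> inner \<alpha> \<beta> = 0"
  shows "R1 = {} \<or> R2 = {}"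
proof (rule ccontr)
  assume "\<not> (R1 = {} \<or> R2 = {})"
  then have "\<exists>R1 R2. R1 \<noteq> {} \<and> R2 \<noteq> {} \<and> R - {0} = R1 \<union> R2 \<and>
      (\<forall>\<alpha>\<in>R1. \<forall>\<beta>\<in>R2. inner \<alpha> \<beta> = 0)"
    using assms(2,3) by (intro exI[of _ R1] exI[of _ R2]) simp
  then show False using assms(1) by (simp add: irreducible_roots_def)
qed

text \<open>
  If the base splits into orthogonal parts, each simple reflection preserves the set of vectors lying
  in one of the two spans, so the whole orbit, and with it the root system, splits too.
\<close>

lemma irreducible_orbit_connected:
  assumes R: "irreducible_roots R" and wb: "reflective_base (S1 \<union> S2) R"
    and orth: "\<And>s t. s \<in> S1 \<Longrightarrow> t \<in> S2 \<Longrightarrow> inner s t = 0"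
  shows "S1 = {} \<or> S2 = {}"
proof (rule ccontr)
  assume ne: "\<not> (S1 = {} \<or> S2 = {})"
  have orth_span: "inner x y = 0" if "x \<in> span S1" "y \<in> span S2" for x y
  proof -
    have "orthogonal s y" if "s \<in> S1" for s
      using orthogonal_to_span[OF \<open>y \<in> span S2\<close>] orth that by (simp add: orthogonal_def)
    then have "orthogonal y x"
      using orthogonal_to_span[OF \<open>x \<in> span S1\<close>, of y] by (simp add: orthogonal_commute)
    then show ?thesis by (simp add: orthogonal_def inner_commute)
  qed
  have split: "x \<in> span S1 \<or> x \<in> span S2" if "x \<in> simple_orbit (S1 \<union> S2)" for x
    using that
  proof induction
    case (base s)
    then show ?case by (auto intro: span_base)
  next
    case (step x s)
    have fix_x: "reflect s x = x" if "inner x s = 0"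
      using that by (simp add: reflect_def cartan_integer_def)
    have "inner x s = 0 \<or> (x \<in> span S1 \<and> s \<in> S1) \<or> (x \<in> span S2 \<and> s \<in> S2)"
      using step orth_span[of x s] orth_span[of s x] by (auto simp: span_base inner_commute)
    then show ?case
      using fix_x step.IH
      by (auto simp: reflect_def intro: span_diff span_scale span_base)
  qed
  have R0: "R - {0} = simple_orbit (S1 \<union> S2)"
    using reflective_base_eq_simple_orbit[OF wb] simple_orbit_subset[OF wb] by auto
  let ?R1 = "(R - {0}) \<inter> span S1" and ?R2 = "(R - {0}) \<inter> span S2"
  have un: "R - {0} = ?R1 \<union> ?R2" using R0 split by blast
  have "S1 \<subseteq> ?R1" "S2 \<subseteq> ?R2"
    using R0 simple_orbit.base[of _ "S1 \<union> S2"] by (auto simp: span_base)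
  then have "?R1 \<noteq> {}" "?R2 \<noteq> {}" using ne by blast+
  then show False
    using irreducible_rootsD[OF R un] orth_span by simp
qed

text \<open>
  The linear map matching the two bases is conformal on \<open>span R\<close>: equality of the Cartan integers
  says that \<open>q j\<close>, the factor by which it scales \<open>\<langle>b j, b j\<rangle>\<close>, also scales \<open>\<langle>b i, b j\<rangle>\<close> for every
  \<open>i\<close>. By symmetry \<open>q i = q j\<close> unless \<open>b i\<close> and \<open>b j\<close> are orthogonal, and irreducibility makes \<open>q\<close>
  constant. A conformal map commutes with the simple reflections, so it carries one orbit onto
  the other, and the orbits are the two root systems.
\<close>

lemma reflective_base_isomorphic:
  fixes R :: "'a::real_inner set" and X :: "'b::real_inner set" and b :: "'i \<Rightarrow> 'a" and g :: "'i \<Rightarrow> 'b"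
  assumes b: "inj_on b J" "reflective_base (b ` J) R"
    and g: "inj_on g J" "reflective_base (g ` J) X"
    and cartan: "\<And>i j. i \<in> J \<Longrightarrow> j \<in> J \<Longrightarrow> cartan_integer (b i) (b j) = cartan_integer (g i) (g j)"
    and R: "irreducible_roots R" "grs R (span R)"
  shows "grs_isomorphic R (span R) X (span X)"
proof -
  note B = reflective_baseD[OF b(2)] and G = reflective_baseD[OF g(2)]
  have nz: "inner (b i) (b i) > 0" "inner (g i) (g i) > 0" if "i \<in> J" for i
  proof -
    have "b i \<noteq> 0" "g i \<noteq> 0"
      using B(2) G(2) dependent_zero[of "b ` J"] dependent_zero[of "g ` J"] that
      by (metis image_eqI)+
    then show "inner (b i) (b i) > 0" "inner (g i) (g i) > 0" by simp_all
  qed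
  obtain f where f: "linear f" "\<And>i. i \<in> J \<Longrightarrow> f (b i) = g i"
    using linear_independent_extend[OF B(2), of "\<lambda>x. g (the_inv_into J b x)"]
    by (auto simp: the_inv_into_f_f[OF b(1)])
  define q where "q i = inner (g i) (g i) / inner (b i) (b i)" for i
  have q: "inner (g i) (g j) = q j * inner (b i) (b j)" if "i \<in> J" "j \<in> J" for i j
    using cartan[OF that] nz[OF that(2)] unfolding cartan_integer_def q_def
    by (simp add: field_simps)
  have "J \<noteq> {}"
  proof
    assume "J = {}"
    then have "R \<subseteq> {0}" using B(5) span_superset[of R] by simp
    then show False using R(1) unfolding irreducible_roots_def by blast
  qed
  then obtain i0 where i0: "i0 \<in> J" by blast
  have qq: "q i = q i0" if "i \<in> J" for i
  proof -
    let ?S1 = "b ` {i \<in> J. q i = q i0}" and ?S2 = "b ` {i \<in> J. q i \<noteq> q i0}"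
    have J: "b ` J = ?S1 \<union> ?S2" by blast
    have "?S1 = {} \<or> ?S2 = {}"
    proof (rule irreducible_orbit_connected[OF R(1) b(2)[unfolded J]])
      fix s t assume "s \<in> ?S1" "t \<in> ?S2"
      then obtain i j where ij: "i \<in> J" "j \<in> J" "s = b i" "t = b j" "q i \<noteq> q j" by auto
      have "q j * inner (b i) (b j) = q i * inner (b j) (b i)"
        using q[OF ij(1,2)] q[OF ij(2,1)] by (simp add: inner_commute)
      then show "inner s t = 0" using ij(3,4,5) by (simp add: inner_commute)
    qed
    then show ?thesis using that i0 by blast
  qed
  define \<kappa> where "\<kappa> = q i0"
  have \<kappa>: "\<kappa> > 0" unfolding \<kappa>_def q_def using nz[OF i0] by simp
  have gb: "inner (g i) (g j) = \<kappa> * inner (b i) (b j)" if "i \<in> J" "j \<in> J" for i j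
    unfolding \<kappa>_def qq[OF that(2), symmetric] by (rule q[OF that])
  have conf: "inner (f x) (f y) = \<kappa> * inner x y" if "x \<in> span R" "y \<in> span R" for x y
  proof (rule conformal_on_span[OF f(1)])
    show "x \<in> span (b ` J)" "y \<in> span (b ` J)" using that B(5) by simp_all
    fix v w assume "v \<in> b ` J" "w \<in> b ` J"
    then show "inner (f v) (f w) = \<kappa> * inner v w" using f(2) gb by auto
  qed
  have bR: "b i \<in> span R" if "i \<in> J" for i using that B(3) span_base by blast
  have refl: "f (reflect (b i) x) = reflect (g i) (f x)" if "i \<in> J" "x \<in> span R" for i x
  proof -
    have "cartan_integer (f x) (g i) = cartan_integer x (b i)"
      unfolding cartan_integer_def f(2)[OF that(1), symmetric]
      using conf bR that \<kappa> by simp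
    then show ?thesis
      using f(2)[OF that(1)] by (simp add: reflect_def linear_diff[OF f(1)] linear_scale[OF f(1)])
  qed
  have orbR: "simple_orbit (b ` J) \<subseteq> span R"
    using simple_orbit_in_span B(5) by blast
  have "f x \<in> simple_orbit (g ` J)" if "x \<in> simple_orbit (b ` J)" for x
    using that
  proof induction
    case (step x s)
    then obtain i where i: "i \<in> J" "s = b i" by blast
    have "x \<in> span R" using step.hyps(1) orbR by blast
    then have "f (reflect s x) = reflect (g i) (f x)" using refl[OF i(1)] i(2) by simp
    then show ?case using step.IH i(1) simple_orbit.step by (metis image_eqI)
  qed (auto simp: f(2) intro: simple_orbit.base)
  moreover have "y \<in> f ` simple_orbit (b ` J)" if "y \<in> simple_orbit (g ` J)" for y
    using that
  proof induction
    case (base s)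
    then obtain i where "i \<in> J" "s = f (b i)" using f(2) by force
    then show ?case by (auto intro: simple_orbit.base)
  next
    case (step y s)
    then obtain i x where ix: "i \<in> J" "s = g i" "x \<in> simple_orbit (b ` J)" "y = f x" by blast
    then have "reflect s y = f (reflect (b i) x)" using refl[OF ix(1), of x] orbR by auto
    then show ?case using ix(1,3) simple_orbit.step by blast
  qed
  ultimately have "f ` simple_orbit (b ` J) = simple_orbit (g ` J)" by blast
  then have fR: "f ` R = X"
    using reflective_base_eq_simple_orbit[OF b(2)] reflective_base_eq_simple_orbit[OF g(2)]
      linear_0[OF f(1)] by (metis image_insert)
  have ker: "x = 0" if "x \<in> span R" "f x = 0" for x
    using conf[OF that(1,1)] that(2) \<kappa> by simp
  have inj: "inj_on f (span R)"
    using linear_inj_on_iff_eq_0[OF f(1) subspace_span] ker by blast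
  have injR: "inj_on f R" using inj by (rule inj_on_subset) (rule span_superset)
  have fspan: "f ` span R = span X"
    using linear_span_image[OF f(1), of R] fR by simp
  have memR: "f x \<in> X \<longleftrightarrow> x \<in> R" if "x \<in> span R" for x
    using inj_on_image_mem_iff[OF inj that span_superset] fR by simp
  note RR = R(2)[unfolded grs_def]
  have "grs X (span X)"
    unfolding grs_def
  proof (intro conjI ballI)
    show "finite X" "X \<noteq> {}" using RR fR by auto
    show "span X = span X" ..
    fix \<alpha> \<beta> assume "\<alpha> \<in> X" "\<beta> \<in> X"
    then obtain x y where xy: "x \<in> R" "y \<in> R" "\<alpha> = f x" "\<beta> = f y" using fR by blast
    have xys: "x \<in> span R" "y \<in> span R" using xy span_base by blast+
    have add: "\<alpha> + \<beta> \<in> X \<longleftrightarrow> x + y \<in> R" and diff: "\<alpha> - \<beta> \<in> X \<longleftrightarrow> x - y \<in> R"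
      using memR[OF span_add[OF xys]] memR[OF span_diff[OF xys]] xy(3,4)
      by (simp_all add: linear_add[OF f(1)] linear_diff[OF f(1)])
    have inn: "inner \<alpha> \<beta> = \<kappa> * inner x y" using conf[OF xys] xy(3,4) by simp
    show "inner \<alpha> \<beta> < 0 \<longrightarrow> \<alpha> + \<beta> \<in> X" "inner \<alpha> \<beta> > 0 \<longrightarrow> \<alpha> - \<beta> \<in> X"
      "inner \<alpha> \<beta> = 0 \<longrightarrow> (\<alpha> + \<beta> \<in> X \<longleftrightarrow> \<alpha> - \<beta> \<in> X)"
      unfolding add diff inn using RR xy(1,2) \<kappa>
      by (simp_all add: mult_less_0_iff zero_less_mult_iff)
  qed
  moreover have "irreducible_roots X"
    unfolding irreducible_roots_def
  proof (intro conjI notI)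
    have f0: "f x = 0 \<longleftrightarrow> x = 0" if "x \<in> R" for x
      using ker span_base[OF that] linear_0[OF f(1)] by blast
    have X0: "X - {0} = f ` (R - {0})" using f0 unfolding fR[symmetric] by auto
    then show False if "X - {0} = {}" using that R(1) unfolding irreducible_roots_def by simp
    assume "\<exists>R1 R2. R1 \<noteq> {} \<and> R2 \<noteq> {} \<and> X - {0} = R1 \<union> R2 \<and>
            (\<forall>\<alpha>\<in>R1. \<forall>\<beta>\<in>R2. inner \<alpha> \<beta> = 0)"
    then obtain X1 X2 where X: "X1 \<noteq> {}" "X2 \<noteq> {}" "X - {0} = X1 \<union> X2"
      "\<forall>\<alpha>\<in>X1. \<forall>\<beta>\<in>X2. inner \<alpha> \<beta> = 0" by (elim exE conjE)
    let ?R1 = "{x \<in> R - {0}. f x \<in> X1}" and ?R2 = "{x \<in> R - {0}. f x \<in> X2}"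
    have XX: "f ` (R - {0}) = X1 \<union> X2" using X(3) X0 by simp
    have hit: "{x \<in> R - {0}. f x \<in> Y} \<noteq> {}" if "Y \<noteq> {}" "Y \<subseteq> f ` (R - {0})" for Y
      using that by blast
    have ne: "?R1 \<noteq> {}" "?R2 \<noteq> {}" using hit X(1,2) unfolding XX by blast+
    have "f x \<in> X1 \<union> X2" if "x \<in> R - {0}" for x using XX that by blast
    then have un: "R - {0} = ?R1 \<union> ?R2" by blast
    have "?R1 = {} \<or> ?R2 = {}"
    proof (rule irreducible_rootsD[OF R(1) un])
      fix \<alpha> \<beta> assume ab: "\<alpha> \<in> ?R1" "\<beta> \<in> ?R2"
      then have "\<kappa> * inner \<alpha> \<beta> = 0"
        using X(4) conf[of \<alpha> \<beta>] span_base[of _ R] by simp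
      then show "inner \<alpha> \<beta> = 0" using \<kappa> by simp
    qed
    then show False using ne by blast
  qed
  moreover have "norm (f x) = sqrt \<kappa> * norm x" if "x \<in> span R" for x
    using conf[OF that that] by (simp add: norm_eq_sqrt_inner real_sqrt_mult)
  ultimately show ?thesis
    unfolding grs_isomorphic_def bij_betw_def
    using R f(1) inj injR fspan fR \<kappa>
    by (intro conjI exI[of _ f] exI[of _ "sqrt \<kappa>"] ballI) simp_all
qed

section \<open>Explicit bases of types A, D and E\<close>

definition unit_seq :: "nat \<Rightarrow> fin_seq" where
  "unit_seq k = Abs_fin_seq (\<lambda>i. if i = k then 1 else 0)"

lemma seq_nth_unit_seq: "seq_nth (unit_seq k) i = (if i = k then 1 else 0)"
  unfolding unit_seq_def by (subst Abs_fin_seq_inverse) auto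

lemma inner_unit_seq: "inner (unit_seq k) y = seq_nth y k"
  by (subst inner_fin_seq_superset[of "{k}"]) (auto simp: seq_nth_unit_seq)

lemma inner_unit_unit: "inner (unit_seq j) (unit_seq k) = (if j = k then 1 else 0)"
  by (simp add: inner_unit_seq seq_nth_unit_seq)

text \<open>
  For types A, D and E the Cartan matrix is symmetric and, simple roots having squared length 2, it
  is the Gram matrix of the base.
\<close>

definition realises :: "cartan_type \<Rightarrow> (nat \<Rightarrow> 'a::real_inner) \<Rightarrow> bool" where
  "realises T \<beta> \<longleftrightarrow>
     inj_on \<beta> {1..type_rank T} \<and> independent (\<beta> ` {1..type_rank T}) \<and>
     (\<forall>i\<in>{1..type_rank T}. \<forall>j\<in>{1..type_rank T}. inner (\<beta> i) (\<beta> j) = of_int (cartan_matrix T i j))"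

lemma realises_inner:
  assumes "realises T \<beta>" "i \<in> {1..type_rank T}" "j \<in> {1..type_rank T}"
  shows "inner (\<beta> i) (\<beta> j) = of_int (cartan_matrix T i j)"
  using assms unfolding realises_def by blast

lemma cartan_matrix_diag [simp]: "cartan_matrix T i i = 2"
  by (simp add: cartan_matrix_def)

text \<open>
  Independence of the explicit bases below follows from families dual to them up to nonzero
  factors: rescaled fundamental weights.
\<close>

lemma dual_family_independent:
  fixes \<beta> \<omega> :: "'i \<Rightarrow> 'a::real_inner"
  assumes J: "finite J"
    and dual: "\<And>i j. i \<in> J \<Longrightarrow> j \<in> J \<Longrightarrow> inner (\<beta> i) (\<omega> j) = 0 \<longleftrightarrow> i \<noteq> j"
  shows "inj_on \<beta> J" "independent (\<beta> ` J)"
proof -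
  show inj: "inj_on \<beta> J"
    by (rule inj_onI) (metis dual)
  have "u (\<beta> j) = 0" if "(\<Sum>v\<in>\<beta> ` J. u v *\<^sub>R v) = 0" "j \<in> J" for u j
  proof -
    have "0 = inner (\<Sum>i\<in>J. u (\<beta> i) *\<^sub>R \<beta> i) (\<omega> j)"
      using that(1) by (simp add: sum.reindex[OF inj])
    also have "\<dots> = (\<Sum>i\<in>J. u (\<beta> i) * inner (\<beta> i) (\<omega> j))"
      by (simp add: inner_sum_left)
    also have "\<dots> = u (\<beta> j) * inner (\<beta> j) (\<omega> j)"
      using J that(2) dual[OF _ that(2)]
      by (subst sum.remove[of J j]) (auto intro!: sum.neutral)
    finally show ?thesis using dual[OF that(2,2)] by simp
  qed
  then show "independent (\<beta> ` J)"
    using J by (auto simp: dependent_finite)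
qed

text \<open>
  The simple roots \<open>e\<^sub>1 - e\<^sub>2, \<dots>, e\<^sub>l\<^sub>-\<^sub>1 - e\<^sub>l, e\<^sub>l\<^sub>-\<^sub>1 + e\<^sub>l\<close> of \<open>D\<^sub>l\<close>.
\<close>

definition D_roots :: "nat \<Rightarrow> nat \<Rightarrow> fin_seq" where
  "D_roots l i = (if i < l then unit_seq i - unit_seq (i + 1) else unit_seq (l - 1) + unit_seq l)"

text \<open>
  The fundamental weights of \<open>D\<^sub>l\<close>, with those of the last two nodes doubled.
\<close>

definition D_weights :: "nat \<Rightarrow> nat \<Rightarrow> fin_seq" where
  "D_weights l i = (\<Sum>k\<in>{1..i}. unit_seq k) - (if i + 1 = l then unit_seq l else 0)"

lemma seq_nth_add: "seq_nth (x + y) i = seq_nth x i + seq_nth y i"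
  and seq_nth_diff: "seq_nth (x - y) i = seq_nth x i - seq_nth y i"
  and seq_nth_scale: "seq_nth (c *\<^sub>R x) i = c * seq_nth x i"
  and seq_nth_zero: "seq_nth 0 i = 0"
  by (simp_all add: plus_fin_seq.rep_eq minus_fin_seq.rep_eq scaleR_fin_seq.rep_eq zero_fin_seq.rep_eq)

lemma seq_nth_sum: "seq_nth (sum f A) i = (\<Sum>a\<in>A. seq_nth (f a) i)"
  by (induction A rule: infinite_finite_induct) (auto simp: seq_nth_add seq_nth_zero)

lemma D_roots_weights:
  assumes "l \<ge> 2" "i \<in> {1..l}" "j \<in> {1..l}"
  shows "inner (D_roots l i) (D_weights l j) = 0 \<longleftrightarrow> i \<noteq> j"
proof -
  have w: "seq_nth (D_weights l j) k =
      (if 1 \<le> k \<and> k \<le> j then 1 else 0) - (if j + 1 = l \<and> k = l then 1 else 0)" for k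
    by (simp add: D_weights_def seq_nth_diff seq_nth_sum seq_nth_zero seq_nth_unit_seq)
  show ?thesis
    using assms by (auto simp: D_roots_def inner_diff_left inner_add_left inner_unit_seq w)
qed

lemma D_roots_inner:
  assumes "l \<ge> 3" "i \<in> {1..l}" "j \<in> {1..l}"
  shows "inner (D_roots l i) (D_roots l j) = of_int (cartan_matrix (type_D l) i j)"
proof -
  note cm = cartan_matrix_def consecutive_def doubleton_eq_iff
  have chain: "inner (D_roots l i) (D_roots l j) = of_int (cartan_matrix (type_D l) i j)"
    if "i < l" "j < l" for i j
    using that assms(1) by (simp add: D_roots_def inner_diff inner_unit_unit cm)
  have fork: "inner (D_roots l i) (D_roots l l) = of_int (cartan_matrix (type_D l) i l)"
    if "i < l" for i
  proof -
    obtain n where l: "l = n + 3" using assms(1) le_Suc_ex by (metis add.commute)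
    consider "i = n + 2" | "i = n + 1" | "i < n + 1" using \<open>i < l\<close> l by linarith
    then show ?thesis
      unfolding l by cases (simp_all add: D_roots_def inner_diff_left inner_add_right inner_unit_unit cm)
  qed
  have sym: "cartan_matrix (type_D l) i j = cartan_matrix (type_D l) j i" for i j
    by (auto simp: cm)
  have self: "inner (D_roots l l) (D_roots l l) = of_int (cartan_matrix (type_D l) l l)"
    using assms(1) by (simp add: D_roots_def inner_add inner_unit_unit cartan_matrix_def)
  consider "i < l" "j < l" | "i < l" "j = l" | "i = l" "j < l" | "i = l" "j = l"
    using assms(2,3) by (simp add: le_less) blast
  then show ?thesis
    using chain fork self sym by cases (simp_all add: inner_commute)
qed

lemma realises_D:
  assumes "l \<ge> 4"
  shows "realises (type_D l) (D_roots l)"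
proof -
  have l: "l \<ge> 2" "l \<ge> 3" using assms by auto
  note ind = dual_family_independent[of "{1..l}" "D_roots l" "D_weights l",
      OF finite_atLeastAtMost D_roots_weights[OF l(1)]]
  show ?thesis
    unfolding realises_def type_rank.simps using ind D_roots_inner[OF l(2)] by blast
qed

text \<open>
  Removing the two end nodes of the fork from the diagram of \<open>D\<^sub>l\<^sub>+\<^sub>2\<close> leaves the chain \<open>A\<^sub>l\<close>.
\<close>

lemma realises_A:
  assumes "l \<ge> 1"
  shows "realises (type_A l) (D_roots (l + 2))"
proof -
  note ind = dual_family_independent[of "{1..l + 2}" "D_roots (l + 2)" "D_weights (l + 2)",
      OF _ D_roots_weights]
  have sub: "{1..l} \<subseteq> {1..l + 2}" by auto
  have "inj_on (D_roots (l + 2)) {1..l}" "independent (D_roots (l + 2) ` {1..l})"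
    using inj_on_subset[OF ind(1) sub] independent_mono[OF ind(2) image_mono[OF sub]] by simp_all
  moreover have "inner (D_roots (l + 2) i) (D_roots (l + 2) j) = of_int (cartan_matrix (type_A l) i j)"
    if "i \<in> {1..l}" "j \<in> {1..l}" for i j
    using that
    by (auto simp: D_roots_def inner_diff inner_add inner_unit_unit cartan_matrix_def consecutive_def)
  ultimately show ?thesis unfolding realises_def by simp
qed

definition E8_roots :: "nat \<Rightarrow> fin_seq" where
  "E8_roots i =
     (if i = 1 then (1/2) *\<^sub>R (unit_seq 1 + unit_seq 8 -
          (unit_seq 2 + unit_seq 3 + unit_seq 4 + unit_seq 5 + unit_seq 6 + unit_seq 7))
      else if i = 2 then unit_seq 1 + unit_seq 2
      else unit_seq (i - 1) - unit_seq (i - 2))"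

lemma E8_node_cases:
  "k \<in> {1..8::nat} \<Longrightarrow>
    k = 1 \<or> k = 2 \<or> k = 3 \<or> k = 4 \<or> k = 5 \<or> k = 6 \<or> k = 7 \<or> k = 8"
  by simp presburger

lemma E8_roots_inner:
  assumes "i \<in> {1..8}" "j \<in> {1..8}"
  shows "inner (E8_roots i) (E8_roots j) = of_int (cartan_matrix type_E8 i j)"
  using E8_node_cases[OF assms(1)] E8_node_cases[OF assms(2)]
  by (elim disjE; hypsubst)
    (simp_all add: E8_roots_def inner_diff inner_add inner_unit_unit cartan_matrix_def
      E_edge_def consecutive_def doubleton_eq_iff)

text \<open>
  The fundamental weights of \<open>E\<^sub>8\<close>, where the weight of node 1 is halved and those of nodes 2 and 3
  are doubled.
\<close>

definition E8_weights :: "nat \<Rightarrow> fin_seq" where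
  "E8_weights i =
     (if i = 1 then unit_seq 8
      else if i = 2 then (\<Sum>k\<in>{1..7}. unit_seq k) + 5 *\<^sub>R unit_seq 8
      else if i = 3 then (\<Sum>k\<in>{2..7}. unit_seq k) - unit_seq 1 + 7 *\<^sub>R unit_seq 8
      else (\<Sum>k\<in>{i - 1..7}. unit_seq k) + real (9 - i) *\<^sub>R unit_seq 8)"

lemma E8_roots_weights:
  assumes "i \<in> {1..8}" "j \<in> {1..8}"
  shows "inner (E8_roots i) (E8_weights j) = 0 \<longleftrightarrow> i \<noteq> j"
  using E8_node_cases[OF assms(1)] E8_node_cases[OF assms(2)]
  by (elim disjE; hypsubst)
    (simp_all add: E8_roots_def E8_weights_def inner_diff_left inner_add_left inner_unit_seq
      seq_nth_diff seq_nth_add seq_nth_scale seq_nth_sum seq_nth_unit_seq)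

text \<open>
  In the numbering used here the diagrams of \<open>E\<^sub>6\<close> and \<open>E\<^sub>7\<close> are initial segments of that of \<open>E\<^sub>8\<close>.
\<close>

lemma realises_E:
  assumes "T \<in> {type_E6, type_E7, type_E8}"
  shows "realises T E8_roots"
proof -
  have T: "type_rank T \<le> 8" "cartan_matrix T = cartan_matrix type_E8"
    using assms by (auto simp: cartan_matrix_def fun_eq_iff)
  then have sub: "{1..type_rank T} \<subseteq> {1..8}" by auto
  note ind = dual_family_independent[of "{1..8}" E8_roots E8_weights, OF _ E8_roots_weights]
  have "inj_on E8_roots {1..type_rank T}" "independent (E8_roots ` {1..type_rank T})"
    using inj_on_subset[OF ind(1) sub] independent_mono[OF ind(2) image_mono[OF sub]] by simp_all
  then show ?thesis unfolding realises_def T(2) using E8_roots_inner sub by blast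
qed

lemma ADE_cases:
  assumes "valid_type T" "is_ADE T"
  obtains (A) l where "T = type_A l" "l \<ge> 1" | (D) l where "T = type_D l" "l \<ge> 4"
    | (E) "T \<in> {type_E6, type_E7, type_E8}"
  using assms by (cases T) auto

lemma ADE_realised:
  assumes "valid_type T" "is_ADE T"
  shows "\<exists>\<beta> :: nat \<Rightarrow> fin_seq. realises T \<beta>"
  using assms
proof (cases rule: ADE_cases)
  case (A l)
  then show ?thesis using realises_A by blast
next
  case (D l)
  then show ?thesis using realises_D by blast
next
  case E
  then show ?thesis using realises_E by blast
qed

lemma realises_simply_laced_base:
  assumes ade: "is_ADE T" and \<beta>: "realises T \<beta>"
  shows "simply_laced_base (\<beta> ` {1..type_rank T})"
proof -
  have off: "cartan_matrix T i j \<in> {0, -1}" if "i \<noteq> j" for i j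
    using that ade by (cases T) (auto simp: cartan_matrix_def)
  have inj: "inj_on \<beta> {1..type_rank T}" "independent (\<beta> ` {1..type_rank T})"
    using \<beta> unfolding realises_def by blast+
  have "if s = t then inner s t = 2 else inner s t \<in> {0, -1}"
    if st: "s \<in> \<beta> ` {1..type_rank T}" "t \<in> \<beta> ` {1..type_rank T}" for s t
  proof -
    obtain i j where ij: "i \<in> {1..type_rank T}" "j \<in> {1..type_rank T}" "s = \<beta> i" "t = \<beta> j"
      using st by blast
    have "s = t \<longleftrightarrow> i = j" using inj_on_eq_iff[OF inj(1) ij(1,2)] ij(3,4) by simp
    then show ?thesis
      using realises_inner[OF \<beta> ij(1,2)] off[of i j] ij(3,4) by auto
  qed
  then show ?thesis unfolding simply_laced_base_def using inj(2) by blast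
qed

text \<open>
  In types A and D every node but the first is joined to one with a smaller number; in type E every
  node but the branch node 4 is joined to one whose number is closer to 4.
\<close>

lemma ADE_connected:
  assumes "valid_type T" "is_ADE T"
  obtains r and h :: "nat \<Rightarrow> nat" where "r \<in> {1..type_rank T}"
    "\<And>i. i \<in> {1..type_rank T} \<Longrightarrow> i \<noteq> r \<Longrightarrow>
        \<exists>j\<in>{1..type_rank T}. h j < h i \<and> cartan_matrix T i j \<noteq> 0"
proof -
  show ?thesis
    using assms
  proof (cases rule: ADE_cases)
    case (A l)
    have "\<exists>j\<in>{1..l}. j < i \<and> cartan_matrix T i j \<noteq> 0" if "i \<in> {1..l}" "i \<noteq> 1" for i
      using that A by (intro bexI[of _ "i - 1"]) (auto simp: cartan_matrix_def consecutive_def)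
    with A that[of 1 "\<lambda>i. i"] show ?thesis by simp
  next
    case (D l)
    have "\<exists>j\<in>{1..l}. j < i \<and> cartan_matrix T i j \<noteq> 0" if "i \<in> {1..l}" "i \<noteq> 1" for i
      using that D by (intro bexI[of _ "if i = l then l - 2 else i - 1"])
        (auto simp: cartan_matrix_def consecutive_def doubleton_eq_iff)
    with D that[of 1 "\<lambda>i. i"] show ?thesis by simp
  next
    case E
    define h :: "nat \<Rightarrow> nat" where "h i = nat \<bar>int i - 4\<bar>" for i
    have rank: "type_rank T \<ge> 6" "cartan_matrix T = cartan_matrix type_E8"
      using E by (auto simp: cartan_matrix_def fun_eq_iff)
    have "\<exists>j\<in>{1..type_rank T}. h j < h i \<and> cartan_matrix T i j \<noteq> 0"
      if i: "i \<in> {1..type_rank T}" "i \<noteq> 4" for i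
    proof -
      consider "i = 1" | "i = 2" | "i = 3" | "i \<ge> 5" using i by fastforce
      then show ?thesis
      proof cases
        case 1 with rank show ?thesis
          by (intro bexI[of _ 3]) (auto simp: h_def cartan_matrix_def E_edge_def)
      next
        case 2 with rank show ?thesis
          by (intro bexI[of _ 4]) (auto simp: h_def cartan_matrix_def E_edge_def)
      next
        case 3 with rank show ?thesis
          by (intro bexI[of _ 4]) (auto simp: h_def cartan_matrix_def E_edge_def consecutive_def)
      next
        case 4 with rank i show ?thesis
          by (intro bexI[of _ "i - 1"]) (auto simp: h_def cartan_matrix_def E_edge_def consecutive_def)
      qed
    qed
    with rank that[of 4 h] show ?thesis by simp
  qed
qed

lemma realises_simply_laced:
  fixes \<beta> :: "nat \<Rightarrow> 'a::real_inner"
  assumes T: "valid_type T" "is_ADE T" and \<beta>: "realises T \<beta>"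
  shows "simply_laced (lattice_roots (\<beta> ` {1..type_rank T}))"
proof -
  let ?J = "{1..type_rank T}"
  let ?R = "lattice_roots (\<beta> ` ?J)"
  have S: "simply_laced_base (\<beta> ` ?J)" by (rule realises_simply_laced_base[OF T(2) \<beta>])
  have inj: "inj_on \<beta> ?J" using \<beta> unfolding realises_def by blast
  note gram = realises_inner[OF \<beta>]
  have "cartan_integer (\<beta> i) (\<beta> j) = of_int (cartan_matrix T i j)" if "i \<in> ?J" "j \<in> ?J" for i j
    using gram[OF that] gram[OF that(2,2)] by (simp add: cartan_integer_def cartan_matrix_def)
  then have type: "has_type ?R T"
    unfolding has_type_def using inj lattice_roots_root_base[OF S] by (intro exI[of _ \<beta>]) simp
  obtain r and h :: "nat \<Rightarrow> nat" where rh: "r \<in> ?J"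
    "\<And>i. i \<in> ?J \<Longrightarrow> i \<noteq> r \<Longrightarrow> \<exists>j\<in>?J. h j < h i \<and> cartan_matrix T i j \<noteq> 0"
    using ADE_connected[OF T] by metis
  have "irreducible_roots ?R"
  proof (rule lattice_roots_irreducible[OF S])
    show "\<beta> r \<in> \<beta> ` ?J" using rh(1) by blast
    fix s assume s: "s \<in> \<beta> ` ?J" "s \<noteq> \<beta> r"
    then obtain i where i: "i \<in> ?J" "i \<noteq> r" "s = \<beta> i" by blast
    then obtain j where j: "j \<in> ?J" "h j < h i" "cartan_matrix T i j \<noteq> 0" using rh(2) by blast
    show "\<exists>t\<in>\<beta> ` ?J. h (the_inv_into ?J \<beta> t) < h (the_inv_into ?J \<beta> s) \<and> inner s t \<noteq> 0"
    proof (rule bexI[OF _ imageI[OF j(1)]])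
      show "h (the_inv_into ?J \<beta> (\<beta> j)) < h (the_inv_into ?J \<beta> s) \<and> inner s (\<beta> j) \<noteq> 0"
        unfolding i(3) the_inv_into_f_f[OF inj i(1)] the_inv_into_f_f[OF inj j(1)]
        using j gram[OF i(1) j(1)] by simp
    qed
  qed
  then show ?thesis
    unfolding simply_laced_def root_system_def
    using lattice_roots_reduced_crystallographic[OF S] T type by meson
qed

section \<open>The quotients, type by type\<close>

definition simply_laced_quotient :: "'a::real_inner set \<Rightarrow> bool" where
  "simply_laced_quotient R \<longleftrightarrow>
     (\<exists>(R' :: fin_seq set) S I.
           simply_laced R' \<and> root_base S R' \<and> I \<subseteq> S \<and>
           grs_isomorphic R (span R) (root_quotient R' I) (quotient_space R' I))"

text \<open>
  What has to be checked in each case: \<open>K\<close> is the set of nodes to be projected away, \<open>\<phi>\<close> matches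
  the nodes of \<open>T\<close> with the remaining ones, and \<open>\<sigma> j\<close> is the coroot of the \<open>j\<close>-th simple root of
  the quotient.
\<close>

lemma quotient_of_type:
  fixes R :: "'a::real_inner set" and \<beta> :: "nat \<Rightarrow> fin_seq"
  assumes R: "root_system R" "has_type R T"
    and T': "valid_type T'" "is_ADE T'" and \<beta>: "realises T' \<beta>"
    and K: "K \<subseteq> {1..type_rank T'}"
    and \<phi>: "bij_betw \<phi> {1..type_rank T} ({1..type_rank T'} - K)"
    and lift: "\<And>j. j \<in> {1..type_rank T} \<Longrightarrow>
        orthogonal_lift (\<beta> ` {1..type_rank T'}) (\<beta> ` K) (\<beta> (\<phi> j)) (\<sigma> j)"
    and cartan: "\<And>i j. i \<in> {1..type_rank T} \<Longrightarrow> j \<in> {1..type_rank T} \<Longrightarrow>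
        inner (\<beta> (\<phi> i)) (\<sigma> j) = of_int (cartan_matrix T i j)"
  shows "simply_laced_quotient R"
proof -
  let ?J = "{1..type_rank T}" and ?J' = "{1..type_rank T'}"
  define S where "S = \<beta> ` ?J'"
  define I where "I = \<beta> ` K"
  define g where "g j = proj_perp I (\<beta> (\<phi> j))" for j
  have S: "simply_laced_base S"
    unfolding S_def by (rule realises_simply_laced_base[OF T'(2) \<beta>])
  have I: "I \<subseteq> S" unfolding S_def I_def using K by blast
  have inj: "inj_on \<beta> ?J'" using \<beta> unfolding realises_def by blast
  have "\<phi> ` ?J = ?J' - K" using \<phi> unfolding bij_betw_def by blast
  then have SI: "S - I = (\<lambda>j. \<beta> (\<phi> j)) ` ?J"
    unfolding S_def I_def using inj_on_image_set_diff[OF inj, of ?J' K] K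
    by (simp add: image_comp[symmetric, unfolded o_def] image_image[symmetric])
  have gJ: "g ` ?J = proj_perp I ` (S - I)"
    unfolding SI g_def by (simp add: image_image)
  have lifts: "\<exists>\<sigma>. orthogonal_lift S I s \<sigma>" if "s \<in> S - I" for s
    using that lift unfolding SI unfolding S_def I_def by blast
  have Q: "reflective_base (proj_perp I ` (S - I)) (root_quotient (lattice_roots S) I)"
    "span (root_quotient (lattice_roots S) I) = quotient_space (lattice_roots S) I"
    by (rule quotient_reflective_base[OF S I]; rule lifts; assumption)+
  have inj_g: "inj_on g ?J"
  proof -
    have 1: "inj_on (proj_perp I) (S - I)"
      using inj_on_proj_perp[OF _ _ I] simply_laced_baseD(1,2)[OF S]
      by (meson inj_on_subset span_superset)
    have \<phi>J: "inj_on \<phi> ?J" "\<phi> ` ?J = ?J' - K" using \<phi> unfolding bij_betw_def by blast+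
    have "inj_on \<beta> (\<phi> ` ?J)" unfolding \<phi>J(2) by (rule inj_on_subset[OF inj Diff_subset])
    from comp_inj_on[OF \<phi>J(1) this] have 2: "inj_on (\<lambda>j. \<beta> (\<phi> j)) ?J" by (simp add: o_def)
    from comp_inj_on[OF 2 1[unfolded SI]] show ?thesis by (simp add: o_def g_def[abs_def])
  qed
  obtain b where b: "inj_on b ?J" "root_base (b ` ?J) R"
    "\<forall>i\<in>?J. \<forall>j\<in>?J. cartan_integer (b i) (b j) = of_int (cartan_matrix T i j)"
    using R(2) unfolding has_type_def by blast
  have R': "reduced_crystallographic R" "irreducible_roots R"
    using R(1) unfolding root_system_def by blast+
  have "grs_isomorphic R (span R) (root_quotient (lattice_roots S) I)
      (span (root_quotient (lattice_roots S) I))"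
  proof (rule reflective_base_isomorphic[OF b(1) _ inj_g])
    show "reflective_base (b ` ?J) R"
      by (rule reduced_crystallographic_reflective_base[OF R'(1) b(2)])
    show "reflective_base (g ` ?J) (root_quotient (lattice_roots S) I)"
      unfolding gJ by (rule Q(1))
    show "irreducible_roots R" by (rule R'(2))
    show "grs R (span R)" by (rule reduced_crystallographic_grs[OF R'(1)])
    fix i j assume ij: "i \<in> ?J" "j \<in> ?J"
    have "cartan_integer (g i) (g j) = inner (\<beta> (\<phi> i)) (\<sigma> j)"
      unfolding g_def
      by (rule cartan_integer_proj_perp[OF S I]) (unfold S_def I_def, rule lift[OF ij(2)])
    then show "cartan_integer (b i) (b j) = cartan_integer (g i) (g j)"
      using b(3) cartan[OF ij] ij by simp
  qed
  then have "grs_isomorphic R (span R) (root_quotient (lattice_roots S) I)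
      (quotient_space (lattice_roots S) I)"
    unfolding Q(2) .
  moreover have "simply_laced (lattice_roots S)"
    unfolding S_def by (rule realises_simply_laced[OF T' \<beta>])
  moreover have "root_base S (lattice_roots S)" by (rule lattice_roots_root_base[OF S])
  ultimately show ?thesis unfolding simply_laced_quotient_def using I by blast
qed

lemma lattice_rootI: "v \<in> root_lattice S \<Longrightarrow> inner v v = 2 \<Longrightarrow> v \<in> lattice_roots S - {0}"
  by (auto simp: lattice_roots_def)

lemma orthogonal_lift_1:
  assumes S: "simply_laced_base S" and "s \<in> S" "\<And>t. t \<in> I \<Longrightarrow> inner s t = 0"
  shows "orthogonal_lift S I s s"
proof -
  have "s \<in> lattice_roots S - {0}"
    by (rule lattice_rootI[OF root_lattice_base[OF simply_laced_baseD(1)[OF S] assms(2)]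
          simply_laced_baseD(3)[OF S assms(2)]])
  then show ?thesis
    unfolding orthogonal_lift_def using assms(3)
    by (intro exI[of _ "{s}"]) (auto simp: span_zero)
qed

text \<open>
  A node \<open>s\<close> with two neighbours \<open>p, q\<close> in \<open>I\<close> that are not joined: \<open>s\<close> and \<open>s + p + q\<close> are orthogonal
  roots, and \<open>s\<close> projects to a root of half the squared length.
\<close>

lemma orthogonal_lift_2:
  assumes S: "simply_laced_base S" and mem: "s \<in> S" "p \<in> I" "q \<in> I" "I \<subseteq> S"
    and inn: "inner s p = -1" "inner s q = -1" "inner p q = 0"
    and orth: "\<And>t. t \<in> I \<Longrightarrow> inner (s + (s + p + q)) t = 0"
  shows "orthogonal_lift S I s (s + (s + p + q))"
proof -
  have inS: "p \<in> S" "q \<in> S" using mem by auto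
  note lat = root_lattice_base[OF simply_laced_baseD(1)[OF S]]
  note sq = simply_laced_baseD(3)[OF S mem(1)] simply_laced_baseD(3)[OF S inS(1)]
    simply_laced_baseD(3)[OF S inS(2)]
  have inn': "inner p s = -1" "inner q s = -1" "inner q p = 0"
    using inn by (simp_all add: inner_commute)
  note ip = sq inn inn' inner_add
  let ?a = "s + p + q"
  have "?a \<in> root_lattice S" "s \<in> root_lattice S"
    using mem(1) inS by (simp_all add: root_lattice_add lat)
  then have roots: "?a \<in> lattice_roots S - {0}" "s \<in> lattice_roots S - {0}"
    by (intro lattice_rootI; simp add: ip)+
  have o: "inner s ?a = 0" "inner ?a s = 0" by (simp_all add: ip)
  then have ne: "s \<noteq> ?a" using sq(1) by force
  have "?a - s \<in> span I"
    using mem(2,3) by (simp add: span_add span_base algebra_simps)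
  then show ?thesis
    unfolding orthogonal_lift_def using orth roots o ne
    by (intro exI[of _ "{s, ?a}"] conjI) (simp_all add: span_zero del: add_left_cancel add_right_cancel)
qed

text \<open>
  A node \<open>s\<close> between two chains \<open>p - p'\<close> and \<open>q - q'\<close> in \<open>I\<close>: the roots \<open>s\<close>, \<open>s + p + q\<close> and
  \<open>s + p + q + p' + q'\<close> are orthogonal, and \<open>s\<close> projects to a root of a third of the squared length.
\<close>

lemma orthogonal_lift_3:
  assumes S: "simply_laced_base S"
    and mem: "s \<in> S" "p \<in> I" "q \<in> I" "p' \<in> I" "q' \<in> I" "I \<subseteq> S"
    and inn: "inner s p = -1" "inner s q = -1" "inner p p' = -1" "inner q q' = -1"
      "inner s p' = 0" "inner s q' = 0" "inner p q = 0" "inner p q' = 0" "inner q p' = 0" "inner p' q' = 0"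
    and orth: "\<And>t. t \<in> I \<Longrightarrow> inner (s + (s + p + q) + (s + p + q + p' + q')) t = 0"
  shows "orthogonal_lift S I s (s + (s + p + q) + (s + p + q + p' + q'))"
proof -
  have inS: "p \<in> S" "q \<in> S" "p' \<in> S" "q' \<in> S" using mem by auto
  note lat = root_lattice_base[OF simply_laced_baseD(1)[OF S]]
  note sq = simply_laced_baseD(3)[OF S mem(1)] simply_laced_baseD(3)[OF S inS(1)]
    simply_laced_baseD(3)[OF S inS(2)] simply_laced_baseD(3)[OF S inS(3)]
    simply_laced_baseD(3)[OF S inS(4)]
  have inn': "inner p s = -1" "inner q s = -1" "inner p' p = -1" "inner q' q = -1"
      "inner p' s = 0" "inner q' s = 0" "inner q p = 0" "inner q' p = 0" "inner p' q = 0" "inner q' p' = 0"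
    using inn by (simp_all add: inner_commute)
  note ip = sq inn inn' inner_add
  define a where "a = s + p + q"
  define b where "b = a + p' + q'"
  have "b \<in> root_lattice S" "a \<in> root_lattice S" "s \<in> root_lattice S"
    unfolding b_def a_def using mem(1) inS by (simp_all add: root_lattice_add lat)
  moreover have sq2: "inner a a = 2" "inner b b = 2" by (simp_all add: a_def b_def ip)
  ultimately have roots: "b \<in> lattice_roots S - {0}" "a \<in> lattice_roots S - {0}" "s \<in> lattice_roots S - {0}"
    using sq(1) lattice_rootI by blast+
  have o: "inner s a = 0" "inner a s = 0" "inner s b = 0" "inner b s = 0" "inner a b = 0" "inner b a = 0"
    by (simp_all add: a_def b_def ip)
  then have ne: "s \<noteq> a" "s \<noteq> b" "a \<noteq> b" using sq(1) sq2 by auto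
  have "a - s \<in> span I" "b - s \<in> span I"
    using mem by (simp_all add: a_def b_def span_add span_base algebra_simps)
  then show ?thesis
    unfolding orthogonal_lift_def a_def[symmetric] b_def[symmetric]
    using orth[folded a_def b_def] roots o ne
    by (intro exI[of _ "{s, a, b}"] conjI) (simp_all add: span_zero add.assoc)
qed

lemma realised_lift_1:
  assumes T: "is_ADE T" and \<beta>: "realises T \<beta>" and K: "K \<subseteq> {1..type_rank T}"
    and i: "i \<in> {1..type_rank T}" and orth: "\<And>k. k \<in> K \<Longrightarrow> cartan_matrix T i k = 0"
  shows "orthogonal_lift (\<beta> ` {1..type_rank T}) (\<beta> ` K) (\<beta> i) (\<beta> i)"
proof (rule orthogonal_lift_1[OF realises_simply_laced_base[OF T \<beta>] imageI[OF i]])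
  fix t assume "t \<in> \<beta> ` K"
  then obtain k where k: "k \<in> K" "t = \<beta> k" by blast
  then show "inner (\<beta> i) t = 0" using realises_inner[OF \<beta> i subsetD[OF K]] orth by simp
qed

lemma realised_lift_2:
  assumes T: "is_ADE T" and \<beta>: "realises T \<beta>" and K: "K \<subseteq> {1..type_rank T}"
    and i: "i \<in> {1..type_rank T}" and pq: "p \<in> K" "q \<in> K"
    and C: "cartan_matrix T i p = -1" "cartan_matrix T i q = -1" "cartan_matrix T p q = 0"
    and orth: "\<And>k. k \<in> K \<Longrightarrow> 2 * cartan_matrix T i k + cartan_matrix T p k + cartan_matrix T q k = 0"
  shows "orthogonal_lift (\<beta> ` {1..type_rank T}) (\<beta> ` K) (\<beta> i) (\<beta> i + (\<beta> i + \<beta> p + \<beta> q))"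
proof (rule orthogonal_lift_2[OF realises_simply_laced_base[OF T \<beta>] imageI[OF i]
      imageI[OF pq(1)] imageI[OF pq(2)] image_mono[OF K]])
  note mem = i subsetD[OF K pq(1)] subsetD[OF K pq(2)]
  note gram = realises_inner[OF \<beta>]
  show "inner (\<beta> i) (\<beta> p) = -1" "inner (\<beta> i) (\<beta> q) = -1" "inner (\<beta> p) (\<beta> q) = 0"
    by (simp_all only: gram[OF mem(1,2)] gram[OF mem(1,3)] gram[OF mem(2,3)] C of_int_minus of_int_1 of_int_0)
  fix t assume "t \<in> \<beta> ` K"
  then obtain k where k: "k \<in> K" "t = \<beta> k" by blast
  have "inner (\<beta> i + (\<beta> i + \<beta> p + \<beta> q)) t
      = of_int (2 * cartan_matrix T i k + cartan_matrix T p k + cartan_matrix T q k)"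
    unfolding k(2) inner_add_left mem[THEN gram[OF _ subsetD[OF K k(1)]]] by simp
  then show "inner (\<beta> i + (\<beta> i + \<beta> p + \<beta> q)) t = 0" by (simp only: orth[OF k(1)] of_int_0)
qed

lemma D_chain:
  "i < n \<Longrightarrow> j < n \<Longrightarrow> cartan_matrix (type_D n) i j =
      (if i = j then 2 else if consecutive i j then -1 else 0)"
  by (auto simp: cartan_matrix_def consecutive_def doubleton_eq_iff)

lemma D_fork:
  "n \<ge> 3 \<Longrightarrow> i < n \<Longrightarrow> cartan_matrix (type_D n) n i = (if i = n - 2 then -1 else 0)"
  "n \<ge> 3 \<Longrightarrow> i < n \<Longrightarrow> cartan_matrix (type_D n) i n = (if i = n - 2 then -1 else 0)"
  by (auto simp: cartan_matrix_def consecutive_def doubleton_eq_iff)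

lemma ADE_case:
  fixes R :: "'a::real_inner set"
  assumes R: "root_system R" "has_type R T" and T: "valid_type T" "is_ADE T"
  shows "simply_laced_quotient R"
proof -
  obtain \<beta> :: "nat \<Rightarrow> fin_seq" where \<beta>: "realises T \<beta>" using ADE_realised[OF T] by blast
  show ?thesis
  proof (rule quotient_of_type[OF R T \<beta>, of "{}" "\<lambda>i. i" \<beta>])
    show "orthogonal_lift (\<beta> ` {1..type_rank T}) (\<beta> ` {}) (\<beta> j) (\<beta> j)"
      if "j \<in> {1..type_rank T}" for j
      using that by (intro realised_lift_1[OF T(2) \<beta>]) auto
    show "inner (\<beta> i) (\<beta> j) = of_int (cartan_matrix T i j)"
      if "i \<in> {1..type_rank T}" "j \<in> {1..type_rank T}" for i j
      by (rule realises_inner[OF \<beta> that])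
  qed (auto simp: bij_betw_def)
qed

text \<open>
  \<open>B\<^sub>l\<close> is the quotient of \<open>D\<^sub>l\<^sub>+\<^sub>2\<close> by the two end nodes of the fork: dropping the last two coordinates
  turns \<open>\<plusminus>e\<^sub>i \<plusminus> e\<^sub>j\<close> into \<open>\<plusminus>e\<^sub>i \<plusminus> e\<^sub>j\<close>, \<open>\<plusminus>e\<^sub>i\<close> or 0. Node \<open>l\<close> becomes short.
\<close>

lemma B_case:
  fixes R :: "'a::real_inner set"
  assumes R: "root_system R" "has_type R (type_B l)" and l: "l \<ge> 2"
  shows "simply_laced_quotient R"
proof -
  let ?T = "type_D (l + 2)" and ?J = "{1..l + 2}"
  have T: "valid_type ?T" "is_ADE ?T" using l by auto
  obtain \<beta> :: "nat \<Rightarrow> fin_seq" where \<beta>: "realises ?T \<beta>" using ADE_realised[OF T] by blast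
  note lift_1 = realised_lift_1[OF T(2) \<beta>, unfolded type_rank.simps]
    and lift_2 = realised_lift_2[OF T(2) \<beta>, unfolded type_rank.simps]
    and gram = realises_inner[OF \<beta>, unfolded type_rank.simps]
  define \<sigma> where "\<sigma> j = (if j = l then \<beta> l + (\<beta> l + \<beta> (l + 1) + \<beta> (l + 2)) else \<beta> j)" for j
  have fork: "3 \<le> l + 2" using l by simp
  note C = D_chain[of _ "l + 2"] D_fork[OF fork]
  show ?thesis
  proof (rule quotient_of_type[OF R T \<beta>, of "{l + 1, l + 2}" "\<lambda>i. i" \<sigma>], unfold type_rank.simps)
    show "bij_betw (\<lambda>i. i) {1..l} ({1..l + 2} - {l + 1, l + 2})"
      by (auto simp: bij_betw_def)
    show "orthogonal_lift (\<beta> ` ?J) (\<beta> ` {l + 1, l + 2}) (\<beta> j) (\<sigma> j)" if j: "j \<in> {1..l}" for j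
    proof (cases "j = l")
      case True
      have "orthogonal_lift (\<beta> ` ?J) (\<beta> ` {l + 1, l + 2}) (\<beta> l)
          (\<beta> l + (\<beta> l + \<beta> (l + 1) + \<beta> (l + 2)))"
      proof (rule lift_2)
        show "2 * cartan_matrix ?T l k + cartan_matrix ?T (l + 1) k + cartan_matrix ?T (l + 2) k = 0"
          if "k \<in> {l + 1, l + 2}" for k
          using that by (elim insertE emptyE; hypsubst) (simp_all add: C[simplified] consecutive_def)
      qed (use l in \<open>simp_all add: C[simplified] consecutive_def\<close>)
      then show ?thesis by (simp add: \<sigma>_def True)
    next
      case False
      have "orthogonal_lift (\<beta> ` ?J) (\<beta> ` {l + 1, l + 2}) (\<beta> j) (\<beta> j)"
      proof (rule lift_1)
        show "cartan_matrix ?T j k = 0" if "k \<in> {l + 1, l + 2}" for k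
          using that j False
          by (elim insertE emptyE; hypsubst) (simp_all add: C[simplified] consecutive_def)
      qed (use j in auto)
      then show ?thesis by (simp add: \<sigma>_def False)
    qed
    show "inner (\<beta> i) (\<sigma> j) = of_int (cartan_matrix (type_B l) i j)"
      if ij: "i \<in> {1..l}" "j \<in> {1..l}" for i j
    proof (cases "j = l")
      case True
      have "inner (\<beta> i) (\<sigma> l) = of_int (2 * cartan_matrix ?T i l + cartan_matrix ?T i (l + 1)
          + cartan_matrix ?T i (l + 2))"
        using ij l by (simp add: \<sigma>_def inner_add_right gram)
      also have "2 * cartan_matrix ?T i l + cartan_matrix ?T i (l + 1) + cartan_matrix ?T i (l + 2)
          = cartan_matrix (type_B l) i l"
      proof -
        consider "i = l" | "i + 1 = l" | "i + 1 < l" using ij by fastforce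
        then show ?thesis
          by cases (auto simp: C[simplified] cartan_matrix_def[of "type_B l"] consecutive_def)
      qed
      finally show ?thesis using True by simp
    next
      case False
      then show ?thesis
        using ij by (auto simp: \<sigma>_def gram C[simplified] cartan_matrix_def[of "type_B l"] consecutive_def)
    qed
  qed simp
qed

text \<open>
  \<open>C\<^sub>l\<close> is the quotient of \<open>D\<^sub>2\<^sub>l\<close> by the odd nodes: identifying \<open>e\<^sub>2\<^sub>i\<^sub>-\<^sub>1\<close> with \<open>e\<^sub>2\<^sub>i\<close> produces
  \<open>\<plusminus>f\<^sub>i \<plusminus> f\<^sub>j\<close> and \<open>\<plusminus>2 f\<^sub>i\<close>. The even nodes below \<open>2 l\<close> have two odd neighbours and become short; node
  \<open>2 l\<close> has none, being joined to \<open>2 l - 2\<close> only, and stays long.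
\<close>

lemma C_case:
  fixes R :: "'a::real_inner set"
  assumes R: "root_system R" "has_type R (type_C l)" and l: "l \<ge> 3"
  shows "simply_laced_quotient R"
proof -
  let ?T = "type_D (2 * l)" and ?J = "{1..2 * l}"
  define K where "K = {k \<in> {1..2 * l}. odd k}"
  have T: "valid_type ?T" "is_ADE ?T" using l by auto
  obtain \<beta> :: "nat \<Rightarrow> fin_seq" where \<beta>: "realises ?T \<beta>" using ADE_realised[OF T] by blast
  note lift_1 = realised_lift_1[OF T(2) \<beta>, unfolded type_rank.simps]
    and lift_2 = realised_lift_2[OF T(2) \<beta>, unfolded type_rank.simps]
    and gram = realises_inner[OF \<beta>, unfolded type_rank.simps]
  define \<sigma> where "\<sigma> j = (if j = l then \<beta> (2 * l)
      else \<beta> (2 * j) + (\<beta> (2 * j) + \<beta> (2 * j - 1) + \<beta> (2 * j + 1)))" for j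
  have fork: "3 \<le> 2 * l" using l by simp
  note C = D_chain[of _ "2 * l"] D_fork[OF fork]
  have KJ: "K \<subseteq> ?J" unfolding K_def by blast
  have K: "k < 2 * l" "odd k" if "k \<in> K" for k
    using that unfolding K_def by (auto simp: le_less)
  show ?thesis
  proof (rule quotient_of_type[OF R T \<beta>, of K "\<lambda>i. 2 * i" \<sigma>], unfold type_rank.simps)
    show "K \<subseteq> ?J" by (rule KJ)
    show "bij_betw (\<lambda>i. 2 * i) {1..l} (?J - K)"
      unfolding K_def by (auto simp: bij_betw_def inj_on_def elim!: evenE)
    show "orthogonal_lift (\<beta> ` ?J) (\<beta> ` K) (\<beta> (2 * j)) (\<sigma> j)" if j: "j \<in> {1..l}" for j
    proof (cases "j = l")
      case True
      have "orthogonal_lift (\<beta> ` ?J) (\<beta> ` K) (\<beta> (2 * l)) (\<beta> (2 * l))"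
      proof (rule lift_1[OF KJ])
        show "cartan_matrix ?T (2 * l) k = 0" if "k \<in> K" for k
          using K[OF that] l by (auto simp: C)
      qed (use l in auto)
      then show ?thesis by (simp add: \<sigma>_def True)
    next
      case False
      then have jl: "1 \<le> j" "j < l" using j by auto
      have "orthogonal_lift (\<beta> ` ?J) (\<beta> ` K) (\<beta> (2 * j))
          (\<beta> (2 * j) + (\<beta> (2 * j) + \<beta> (2 * j - 1) + \<beta> (2 * j + 1)))"
      proof (rule lift_2[OF KJ])
        show "2 * j - 1 \<in> K" "2 * j + 1 \<in> K" "2 * j \<in> ?J" using jl by (auto simp: K_def)
        show "cartan_matrix ?T (2 * j) (2 * j - 1) = -1" "cartan_matrix ?T (2 * j) (2 * j + 1) = -1"
          "cartan_matrix ?T (2 * j - 1) (2 * j + 1) = 0"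
          using jl by (cases j; simp add: C consecutive_def)+
        fix k assume "k \<in> K"
        note k = K[OF this]
        consider "k = 2 * j - 1" | "k = 2 * j + 1" | "k \<noteq> 2 * j - 1" "k \<noteq> 2 * j + 1" by blast
        then show "2 * cartan_matrix ?T (2 * j) k + cartan_matrix ?T (2 * j - 1) k
            + cartan_matrix ?T (2 * j + 1) k = 0"
        proof cases
          case 3
          have "k \<noteq> 2 * j" "\<not> consecutive (2 * j) k" "\<not> consecutive (2 * j - 1) k"
            "\<not> consecutive (2 * j + 1) k"
            using 3 k jl unfolding consecutive_def by presburger+
          with 3 k jl show ?thesis by (simp add: C)
        qed (use jl in \<open>cases j; simp add: C consecutive_def\<close>)+
      qed
      then show ?thesis by (simp add: \<sigma>_def False)
    qed
    show "inner (\<beta> (2 * i)) (\<sigma> j) = of_int (cartan_matrix (type_C l) i j)"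
      if ij: "i \<in> {1..l}" "j \<in> {1..l}" for i j
    proof (cases "j = l")
      case True
      have "cartan_matrix ?T (2 * i) (2 * l) = cartan_matrix (type_C l) i l"
        using ij(1) l by (cases "i = l") (auto simp: C cartan_matrix_def[of "type_C l"] consecutive_def)
      then show ?thesis using True ij l by (simp add: \<sigma>_def gram)
    next
      case False
      then have j: "1 \<le> j" "j < l" using ij by auto
      have i: "1 \<le> i" "i \<le> l" using ij by auto
      have "inner (\<beta> (2 * i)) (\<sigma> j) = of_int (2 * cartan_matrix ?T (2 * i) (2 * j)
          + cartan_matrix ?T (2 * i) (2 * j - 1) + cartan_matrix ?T (2 * i) (2 * j + 1))"
        using i j by (cases j) (simp_all add: \<sigma>_def inner_add_right gram)
      also have "2 * cartan_matrix ?T (2 * i) (2 * j) + cartan_matrix ?T (2 * i) (2 * j - 1)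
          + cartan_matrix ?T (2 * i) (2 * j + 1) = cartan_matrix (type_C l) i j"
      proof (cases "i = l")
        case True
        have "2 * j - 1 \<noteq> 2 * l - 2" "2 * j + 1 \<noteq> 2 * l - 2" using j by presburger+
        then show ?thesis
          using True j by (auto simp: C cartan_matrix_def[of "type_C l"] consecutive_def)
      next
        case False
        then have i: "1 \<le> i" "i < l" using i by auto
        obtain a b where ab: "i = Suc a" "j = Suc b" using i(1) j(1) by (metis Suc_le_D One_nat_def)
        consider "a = b" | "a = Suc b" | "b = Suc a" | "Suc a < b" | "Suc b < a" by linarith
        then show ?thesis
          using i(2) j(2) unfolding ab
          by cases (auto simp: C cartan_matrix_def[of "type_C l"] consecutive_def)
      qed
      finally show ?thesis .
    qed
  qed
qed

text \<open>
  \<open>F\<^sub>4\<close> is the quotient of \<open>E\<^sub>7\<close> by the mutually orthogonal nodes 2, 5 and 7. The nodes 1 and 3 are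
  not joined to any of them and stay long; 4 and 6 have two neighbours among them and become short.
\<close>

lemma F_case:
  fixes R :: "'a::real_inner set"
  assumes R: "root_system R" "has_type R type_F4"
  shows "simply_laced_quotient R"
proof -
  let ?T = "type_E7" and ?J = "{1..7::nat}" and ?K = "{2, 5, 7::nat}"
  have T: "valid_type ?T" "is_ADE ?T" by auto
  obtain \<beta> :: "nat \<Rightarrow> fin_seq" where \<beta>: "realises ?T \<beta>" using ADE_realised[OF T] by blast
  note lift_1 = realised_lift_1[OF T(2) \<beta>, of ?K, unfolded type_rank.simps]
    and lift_2 = realised_lift_2[OF T(2) \<beta>, of ?K, unfolded type_rank.simps]
    and gram = realises_inner[OF \<beta>, unfolded type_rank.simps]
  define \<phi> :: "nat \<Rightarrow> nat" where "\<phi> i = (if i = 1 then 1 else if i = 2 then 3 else if i = 3 then 4 else 6)" for i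
  define \<sigma> where "\<sigma> j = (if j = 1 then \<beta> 1 else if j = 2 then \<beta> 3
      else if j = 3 then \<beta> 4 + (\<beta> 4 + \<beta> 2 + \<beta> 5) else \<beta> 6 + (\<beta> 6 + \<beta> 5 + \<beta> 7))" for j :: nat
  note cm = cartan_matrix_def E_edge_def consecutive_def doubleton_eq_iff
  have four: "j = 1 \<or> j = 2 \<or> j = 3 \<or> j = 4" if "j \<in> {1..4}" for j :: nat
    using that by simp presburger
  have lifts: "orthogonal_lift (\<beta> ` ?J) (\<beta> ` ?K) (\<beta> 1) (\<beta> 1)"
    "orthogonal_lift (\<beta> ` ?J) (\<beta> ` ?K) (\<beta> 3) (\<beta> 3)"
    "orthogonal_lift (\<beta> ` ?J) (\<beta> ` ?K) (\<beta> 4) (\<beta> 4 + (\<beta> 4 + \<beta> 2 + \<beta> 5))"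
    "orthogonal_lift (\<beta> ` ?J) (\<beta> ` ?K) (\<beta> 6) (\<beta> 6 + (\<beta> 6 + \<beta> 5 + \<beta> 7))"
    by ((rule lift_1 lift_2; auto simp: cm)+)
  show ?thesis
  proof (rule quotient_of_type[OF R T \<beta>, of ?K \<phi> \<sigma>], unfold type_rank.simps)
    have "{1..4::nat} = {1, 2, 3, 4}" "?J - ?K = {1, 3, 4, 6}" by auto
    then show "bij_betw \<phi> {1..4} (?J - ?K)"
      by (auto simp: bij_betw_def \<phi>_def)
    show "orthogonal_lift (\<beta> ` ?J) (\<beta> ` ?K) (\<beta> (\<phi> j)) (\<sigma> j)" if "j \<in> {1..4}" for j
      using four[OF that] lifts by (elim disjE; hypsubst) (simp_all add: \<sigma>_def \<phi>_def)
    show "inner (\<beta> (\<phi> i)) (\<sigma> j) = of_int (cartan_matrix type_F4 i j)"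
      if "i \<in> {1..4}" "j \<in> {1..4}" for i j
      using four[OF that(1)] four[OF that(2)]
      by (elim disjE; hypsubst) (simp_all add: \<sigma>_def \<phi>_def gram cm inner_add_right)
  qed auto
qed

text \<open>
  \<open>G\<^sub>2\<close> is the quotient of \<open>E\<^sub>6\<close> by its two arms \<open>3 - 1\<close> and \<open>5 - 6\<close>. Node 2 stays long, and the
  branch node 4 becomes short, the squared lengths being in ratio 3.
\<close>

lemma G_case:
  fixes R :: "'a::real_inner set"
  assumes R: "root_system R" "has_type R type_G2"
  shows "simply_laced_quotient R"
proof -
  let ?T = "type_E6" and ?J = "{1..6::nat}" and ?K = "{1, 3, 5, 6::nat}"
  have T: "valid_type ?T" "is_ADE ?T" by auto
  obtain \<beta> :: "nat \<Rightarrow> fin_seq" where \<beta>: "realises ?T \<beta>" using ADE_realised[OF T] by blast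
  note S = realises_simply_laced_base[OF T(2) \<beta>, unfolded type_rank.simps]
    and lift_1 = realised_lift_1[OF T(2) \<beta>, of ?K, unfolded type_rank.simps]
    and gram = realises_inner[OF \<beta>, unfolded type_rank.simps]
  define \<phi> :: "nat \<Rightarrow> nat" where "\<phi> i = (if i = 1 then 4 else 2)" for i
  define \<sigma> where "\<sigma> j = (if j = 1
      then \<beta> 4 + (\<beta> 4 + \<beta> 3 + \<beta> 5) + (\<beta> 4 + \<beta> 3 + \<beta> 5 + \<beta> 1 + \<beta> 6) else \<beta> 2)" for j :: nat
  note cm = cartan_matrix_def E_edge_def consecutive_def doubleton_eq_iff
  have two: "j = 1 \<or> j = 2" if "j \<in> {1..2}" for j :: nat
    using that by simp presburger
  have short: "orthogonal_lift (\<beta> ` ?J) (\<beta> ` ?K) (\<beta> 4)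
      (\<beta> 4 + (\<beta> 4 + \<beta> 3 + \<beta> 5) + (\<beta> 4 + \<beta> 3 + \<beta> 5 + \<beta> 1 + \<beta> 6))"
  proof (rule orthogonal_lift_3[OF S])
    fix t assume "t \<in> \<beta> ` ?K"
    then have "t = \<beta> 1 \<or> t = \<beta> 3 \<or> t = \<beta> 5 \<or> t = \<beta> 6" by blast
    then show "inner (\<beta> 4 + (\<beta> 4 + \<beta> 3 + \<beta> 5) + (\<beta> 4 + \<beta> 3 + \<beta> 5 + \<beta> 1 + \<beta> 6)) t = 0"
      by (elim disjE; hypsubst) (simp_all add: gram cm inner_add_left)
  qed (auto simp: gram cm)
  have long: "orthogonal_lift (\<beta> ` ?J) (\<beta> ` ?K) (\<beta> 2) (\<beta> 2)"
    by (rule lift_1; auto simp: cm)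
  show ?thesis
  proof (rule quotient_of_type[OF R T \<beta>, of ?K \<phi> \<sigma>], unfold type_rank.simps)
    have "{1..2::nat} = {1, 2}" "?J - ?K = {2, 4}" by auto
    then show "bij_betw \<phi> {1..2} (?J - ?K)"
      by (auto simp: bij_betw_def \<phi>_def)
    show "orthogonal_lift (\<beta> ` ?J) (\<beta> ` ?K) (\<beta> (\<phi> j)) (\<sigma> j)" if "j \<in> {1..2}" for j
      using two[OF that] short long by (elim disjE; hypsubst) (simp_all add: \<sigma>_def \<phi>_def)
    show "inner (\<beta> (\<phi> i)) (\<sigma> j) = of_int (cartan_matrix type_G2 i j)"
      if "i \<in> {1..2}" "j \<in> {1..2}" for i j
      using two[OF that(1)] two[OF that(2)]
      by (elim disjE; hypsubst) (simp_all add: \<sigma>_def \<phi>_def gram cm inner_add_right)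
  qed auto
qed

theorem theorem4p6:
  fixes R :: "'a::real_inner set"
  assumes "root_system R"
  shows "\<exists>(R' :: fin_seq set) S I.
           simply_laced R' \<and> root_base S R' \<and> I \<subseteq> S \<and>
           grs_isomorphic R (span R) (root_quotient R' I) (quotient_space R' I)"
proof -
  obtain T where T: "valid_type T" "has_type R T"
    using assms unfolding root_system_def by blast
  have "simply_laced_quotient R"
  proof (cases "is_ADE T")
    case True
    then show ?thesis using ADE_case[OF assms T(2,1)] by blast
  next
    case False
    then show ?thesis
      using T B_case[OF assms] C_case[OF assms] F_case[OF assms] G_case[OF assms]
      by (cases T) auto
  qed
  then show ?thesis unfolding simply_laced_quotient_def .
qed

end
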